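(* Let $n\ge 1$, let $\mathscr{R}_n=\overline{N_{\mathrm{PGL}_n}(T)}/T$ be the $\mathbb{P}M$-monoid, let $S_n$ be the symmetric group, and let $P_n$ be the monoid of ordered set partitions of $[n]=\{1,\dots,n\}$. Define $$\varphi:P_n\times S_n\to S_n\times P_n,\qquad ((p_1,\dots,p_m),w)\mapsto \bigl(w,(w^{-1}(p_1),\dots,w^{-1}(p_m))\bigr).$$ Then there is an isomorphism of monoids $$\mathscr{R}_n\simeq S_n\Join_{\varphi}P_n .$$
   Context: **The space $\mathbb{P}M$.** Let $V=\mathbb{C}^n$. Let $M$ be the set of finite sequences $(A_0,\dots,A_m)$, $m\ge 0$, with $0\ne A_i\in\mathrm{Hom}(V_i,V)$, $V_0=V$, $V_{i+1}=\mathrm{Ker}(A_i)$ for $0\le i\le m$, and $V_{m+1}=0$. Write $V(\mathbb{A})_i=V_i$. Let $\mathbb{P}M$ be the set of sequences $(\overline{A_0},\dots,\overline{A_m})$ of classes $\overline{A_i}\in\mathbb{P}\mathrm{Hom}(V_i,V)$ with $(A_0,\dots,A_m)\in M$. $\mathrm{PGL}_n$ is the set of one-term elements of $\mathbb{P}M$. **Topology.** For $\mathbb{A}=(A_0,\dots,A_m)\in M$ and neighbourhoods $U_i$ of $\overline{A_i}$ in $\mathbb{P}\mathrm{Hom}(V(\mathbb{A})_i,V)$ (classical topology), let $U(U_0,\dots,U_m)$ be the set of $(\overline{B_0},\dots,\overline{B_{r}})\in\mathbb{P}M$ such that for every $i\in\{0,\dots,m\}$ there is $j\in\{0,\dots,r\}$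 with $V(\mathbb{B})_j\supseteq V(\mathbb{A})_i$ and $\overline{B_j|_{V(\mathbb{A})_i}}\in U_i$. These sets form a base of neighbourhoods of $\mathbb{P}\mathbb{A}$ and define the topology of $\mathbb{P}M$. **The monoid $\mathscr{R}_n$.** Let $T$ be a maximal torus of $\mathrm{PGL}_n$; choose a basis of $V$ in which $T$ is diagonal, with the Hermitian inner product making this basis orthonormal, and let $E_{ij}$ be the matrix units. For a subspace $W\subseteq V$, regard $\mathrm{Hom}(W,V)\subseteq\mathrm{End}(V)$ via extension by $0$ on $W^\perp$. The closure $\overline{N_{\mathrm{PGL}_n}(T)}$ is taken in $\mathbb{P}M$. It is a monoid under $$(A_0,\dots,A_m)(B_0,\dots,B_r)=(A_0B_0,A_1B_0,\dots,A_mB_0,A_0B_1,\dots,A_mB_1,\dots,A_0B_r,\dots,A_mB_r)$$ with redundant matrices removed, a matrix being redundant if its kernel contains the intersection of the kernels of the preceding matrices in the list. $\mathscr{R}_n=\overline{N_{\mathrm{PGL}_n}(T)}/T$ is the quotient by multiplication by $T$, with the induced product. **The monoid $P_n$.** $P_n$ is the set of ordered set partitions $(p_1,\dots,p_m)$ ($m\ge1$) of $[n]$ into nonempty blocks, with product $$(p_1,\dots,p_m)*(p_1',\dots,p'_{m'})=(p_1\cap p_1',\dots,p_m\cap p_1',\dots,p_1\cap p'_{m'},\dots,p_m\cap p'_{m'}),$$ empty intersections being removed. **Matched pairs.** A matched pair of monoids is a triple $(S,B,\sigma)$ with $S,B$ monoids and $\sigma:S\times B\to B\times S$, $(s,b)\mapsto(s\rightharpoonup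 b,\,s\leftharpoonup b)$, such that for all $s,t\in S$, $b,c\in B$: (1) $s\rightharpoonup(t\rightharpoonup b)=st\rightharpoonup b$; (2) $st\leftharpoonup b=(s\leftharpoonup(t\rightharpoonup b))(t\leftharpoonup b)$; (3) $(s\leftharpoonup b)\leftharpoonup c=s\leftharpoonup bc$; (4) $s\rightharpoonup bc=(s\rightharpoonup b)((s\leftharpoonup b)\rightharpoonup c)$; (5) $1_S\rightharpoonup b=b$; (6) $s\rightharpoonup1_B=1_B$; (7) $s\leftharpoonup1_B=s$; (8) $1_S\leftharpoonup b=1_S$. Then $B\Join_\sigma S$ is the monoid on the set $B\times S$ with product $(b,s)(c,t)=(b(s\rightharpoonup c),(s\leftharpoonup c)t)$. Here the matched pair is $(P_n,S_n,\varphi)$. Permutations are composed as functions, right to left. *)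

theory Defs
  imports
    "HOL-Analysis.Analysis"
    "HOL-Library.Disjoint_Sets"
    "HOL-Algebra.Coset"
    "HOL-Algebra.Group_Action"
    "HOL-Algebra.Product_Groups"
    "HOL-Algebra.Sym_Groups"
begin

section \<open>The space PM\<close>

text \<open>Throughout, \<open>V\<close> is the type \<open>complex ^ 'n\<close>, so that \<open>n = CARD('n)\<close>.
  A linear map \<open>W \<rightarrow> V\<close> on a subspace \<open>W\<close> is encoded as a function on all of \<open>V\<close> that vanishes
  off \<open>W\<close>. This is only a normal form for functions with domain \<open>W\<close> (it is not a linear
  extension to \<open>V\<close>), and it makes the zero map the constant zero function.\<close>

definition restr :: "'a set \<Rightarrow> ('a \<Rightarrow> 'b) \<Rightarrow> 'a \<Rightarrow> 'b::zero" where
  "restr W f = (\<lambda>v. if v \<in> W then f v else 0)"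

definition Hom :: "(complex ^ 'n::finite) set \<Rightarrow> (complex ^ 'n \<Rightarrow> complex ^ 'n) set" where
  "Hom W = {f. (\<forall>u\<in>W. \<forall>v\<in>W. f (u + v) = f u + f v) \<and>
               (\<forall>c. \<forall>v\<in>W. f (c *s v) = c *s f v) \<and>
               (\<forall>v. v \<notin> W \<longrightarrow> f v = 0)}"

definition pclass :: "(complex ^ 'n::finite \<Rightarrow> complex ^ 'n) \<Rightarrow> (complex ^ 'n \<Rightarrow> complex ^ 'n) set" where
  "pclass f = {(\<lambda>v. c *s f v) | c. c \<noteq> 0}"

definition Hom_nonzero :: "(complex ^ 'n::finite) set \<Rightarrow> (complex ^ 'n \<Rightarrow> complex ^ 'n) set" where
  "Hom_nonzero W = Hom W - {\<lambda>v. 0}"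

definition PHom :: "(complex ^ 'n::finite) set \<Rightarrow> (complex ^ 'n \<Rightarrow> complex ^ 'n) set set" where
  "PHom W = pclass ` Hom_nonzero W"

text \<open>The classical topology of \<open>PHom W\<close> is the quotient topology from the nonzero elements of
  \<open>Hom W\<close>. The topology of the function type is that of pointwise convergence, which on the
  finite-dimensional space \<open>Hom W\<close> is the usual one.\<close>

definition phom_open :: "(complex ^ 'n::finite) set \<Rightarrow> (complex ^ 'n \<Rightarrow> complex ^ 'n) set set \<Rightarrow> bool" where
  "phom_open W U \<longleftrightarrow> U \<subseteq> PHom W \<and>
     openin (top_of_set (Hom_nonzero W)) {f \<in> Hom_nonzero W. pclass f \<in> U}"

definition phom_topology ::
  "(complex ^ 'n::finite) set \<Rightarrow> (complex ^ 'n \<Rightarrow> complex ^ 'n) set topology" where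
  "phom_topology W = topology (phom_open W)"

lemma istopology_phom_open: "istopology (phom_open W)"
  unfolding istopology_def
proof (intro conjI allI impI)
  fix S T assume a: "phom_open W S" "phom_open W T"
  have eq: "{f \<in> Hom_nonzero W. pclass f \<in> S \<inter> T} =
      {f \<in> Hom_nonzero W. pclass f \<in> S} \<inter> {f \<in> Hom_nonzero W. pclass f \<in> T}" by auto
  show "phom_open W (S \<inter> T)"
    using a unfolding phom_open_def eq by (simp add: openin_Int le_infI1)
next
  fix K assume a: "\<forall>S\<in>K. phom_open W S"
  have eq: "{f \<in> Hom_nonzero W. pclass f \<in> \<Union>K} =
      (\<Union>S\<in>K. {f \<in> Hom_nonzero W. pclass f \<in> S})" by auto
  have "openin (top_of_set (Hom_nonzero W)) (\<Union>S\<in>K. {f \<in> Hom_nonzero W. pclass f \<in> S})"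
    using a unfolding phom_open_def by (intro openin_Union) auto
  moreover have "\<Union>K \<subseteq> PHom W" using a unfolding phom_open_def by blast
  ultimately show "phom_open W (\<Union>K)" unfolding phom_open_def eq by blast
qed

lemma openin_phom_topology: "openin (phom_topology W) = phom_open W"
  by (simp add: phom_topology_def istopology_phom_open)

text \<open>For a sequence of maps, \<open>common_ker As i\<close> is the common kernel of the maps with index
  below \<open>i\<close>; for \<open>As \<in> M\<close> it is the space \<open>V(As)\<^sub>i\<close>.\<close>

primrec common_ker :: "('a \<Rightarrow> 'b::zero) list \<Rightarrow> nat \<Rightarrow> 'a set" where
  "common_ker As 0 = UNIV"
| "common_ker As (Suc i) = {v \<in> common_ker As i. (As ! i) v = 0}"

definition M_set :: "(complex ^ 'n::finite \<Rightarrow> complex ^ 'n) list set" where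
  "M_set = {As. As \<noteq> [] \<and> (\<forall>i < length As. As ! i \<in> Hom_nonzero (common_ker As i)) \<and>
                common_ker As (length As) = {0}}"

type_synonym 'n pm = "(complex ^ 'n \<Rightarrow> complex ^ 'n) set list"

definition PM :: "('n::finite) pm set" where
  "PM = map pclass ` M_set"

text \<open>If \<open>B\<^sub>j\<close> restricts to zero on \<open>V(A)\<^sub>i\<close>, its class is \<open>{0}\<close>, which is not in \<open>PHom\<close>,
  so the membership in \<open>U\<^sub>i\<close> below includes that the restriction is nonzero.\<close>

definition basic_nbhd ::
  "(complex ^ 'n::finite \<Rightarrow> complex ^ 'n) list \<Rightarrow> (complex ^ 'n \<Rightarrow> complex ^ 'n) set set list \<Rightarrow> 'n pm set"
  where
  "basic_nbhd As Us = {map pclass Bs | Bs. Bs \<in> M_set \<and>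
     (\<forall>i < length As. \<exists>j < length Bs. common_ker As i \<subseteq> common_ker Bs j \<and>
        pclass (restr (common_ker As i) (Bs ! j)) \<in> Us ! i)}"

definition nbhd_data ::
  "(complex ^ 'n::finite \<Rightarrow> complex ^ 'n) list \<Rightarrow> (complex ^ 'n \<Rightarrow> complex ^ 'n) set set list \<Rightarrow> bool"
  where
  "nbhd_data As Us \<longleftrightarrow> length Us = length As \<and>
     (\<forall>i < length As. openin (phom_topology (common_ker As i)) (Us ! i) \<and> pclass (As ! i) \<in> Us ! i)"

definition pm_open :: "('n::finite) pm set \<Rightarrow> bool" where
  "pm_open S \<longleftrightarrow> S \<subseteq> PM \<and>
     (\<forall>As\<in>M_set. map pclass As \<in> S \<longrightarrow> (\<exists>Us. nbhd_data As Us \<and> basic_nbhd As Us \<subseteq> S))"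

definition PM_topology :: "('n::finite) pm topology" where
  "PM_topology = topology pm_open"

lemma istopology_pm_open: "istopology pm_open"
  unfolding istopology_def
proof (intro conjI allI impI)
  fix S T :: "'a pm set" assume a: "pm_open S" "pm_open T"
  have "\<exists>Ws. nbhd_data As Ws \<and> basic_nbhd As Ws \<subseteq> S \<inter> T"
    if As: "As \<in> M_set" "map pclass As \<in> S \<inter> T" for As
  proof -
    obtain Us Us' where U: "nbhd_data As Us" "basic_nbhd As Us \<subseteq> S"
      "nbhd_data As Us'" "basic_nbhd As Us' \<subseteq> T"
      using a As unfolding pm_open_def by blast
    define Ws where "Ws = map (\<lambda>i. Us ! i \<inter> Us' ! i) [0..<length As]"
    have nth: "Ws ! i = Us ! i \<inter> Us' ! i" if "i < length As" for i
      using that by (simp add: Ws_def)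
    have len: "length Ws = length As" by (simp add: Ws_def)
    have mono: "basic_nbhd As Ws \<subseteq> basic_nbhd As Xs"
      if sub: "\<And>i. i < length As \<Longrightarrow> Ws ! i \<subseteq> Xs ! i" for Xs
    proof
      fix y assume "y \<in> basic_nbhd As Ws"
      then obtain Bs where y: "y = map pclass Bs" and Bs: "Bs \<in> M_set"
        and *: "\<forall>i < length As. \<exists>j < length Bs. common_ker As i \<subseteq> common_ker Bs j \<and>
          pclass (restr (common_ker As i) (Bs ! j)) \<in> Ws ! i"
        unfolding basic_nbhd_def mem_Collect_eq by (elim exE conjE)
      have "\<forall>i < length As. \<exists>j < length Bs. common_ker As i \<subseteq> common_ker Bs j \<and>
          pclass (restr (common_ker As i) (Bs ! j)) \<in> Xs ! i"
        using * sub by (meson subsetD)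
      with y Bs show "y \<in> basic_nbhd As Xs"
        unfolding basic_nbhd_def mem_Collect_eq by (intro exI conjI)
    qed
    have "nbhd_data As Ws"
      using U(1,3) unfolding nbhd_data_def by (simp add: nth len openin_Int)
    moreover have "basic_nbhd As Ws \<subseteq> basic_nbhd As Us" by (rule mono) (simp add: nth)
    moreover have "basic_nbhd As Ws \<subseteq> basic_nbhd As Us'" by (rule mono) (simp add: nth)
    ultimately show ?thesis using U(2,4) by (meson le_inf_iff order_trans)
  qed
  moreover have "S \<inter> T \<subseteq> PM" using a(1) unfolding pm_open_def by (simp add: le_infI1)
  ultimately show "pm_open (S \<inter> T)"
    unfolding pm_open_def by (intro conjI ballI impI) auto
next
  fix K :: "'a pm set set" assume a: "\<forall>S\<in>K. pm_open S"
  have "\<exists>Us. nbhd_data As Us \<and> basic_nbhd As Us \<subseteq> \<Union>K"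
    if As: "As \<in> M_set" "map pclass As \<in> \<Union>K" for As
  proof -
    obtain S where S: "S \<in> K" "map pclass As \<in> S" using As(2) by (rule UnionE)
    then obtain Us where "nbhd_data As Us" "basic_nbhd As Us \<subseteq> S"
      using a As(1) unfolding pm_open_def by meson
    then show ?thesis using S(1) by (meson Union_upper order_trans)
  qed
  moreover have "\<Union>K \<subseteq> PM"
    using a unfolding pm_open_def by (intro Sup_least) simp
  ultimately show "pm_open (\<Union>K)"
    unfolding pm_open_def by (intro conjI ballI impI) auto
qed

lemma openin_PM_topology: "openin PM_topology = pm_open"
  by (simp add: PM_topology_def istopology_pm_open)

lemma topspace_PM_topology: "topspace PM_topology = PM"
proof -
  have "pm_open (PM :: 'a pm set)"
    unfolding pm_open_def
  proof (intro conjI ballI impI subset_refl)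
    fix As :: "(complex ^ 'a \<Rightarrow> complex ^ 'a) list" assume As: "As \<in> M_set"
    define Us where "Us = map (\<lambda>i. PHom (common_ker As i)) [0..<length As]"
    have *: "phom_open W (PHom W)" for W :: "(complex ^ 'a) set"
    proof -
      have "{f \<in> Hom_nonzero W. pclass f \<in> PHom W} = Hom_nonzero W" by (auto simp: PHom_def)
      then show ?thesis by (simp add: phom_open_def)
    qed
    have "nbhd_data As Us"
      using As * by (auto simp: nbhd_data_def Us_def openin_phom_topology PHom_def M_set_def)
    moreover have "basic_nbhd As Us \<subseteq> PM" by (auto simp: basic_nbhd_def PM_def)
    ultimately show "\<exists>Us. nbhd_data As Us \<and> basic_nbhd As Us \<subseteq> PM" by blast
  qed
  then show ?thesis
    unfolding topspace_def openin_PM_topology by (auto simp: pm_open_def)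
qed


section \<open>The projective linear group and its maximal tori\<close>

definition PGL :: "('n::finite) pm monoid" where
  "PGL = \<lparr>carrier = {x \<in> PM. length x = 1},
          mult = (\<lambda>x y. [{A \<circ> B | A B. A \<in> hd x \<and> B \<in> hd y}]),
          one = [pclass id]\<rparr>"

text \<open>The function with value \<open>A\<^sub>i\<^sub>j (A\<^sup>-\<^sup>1)\<^sub>k\<^sub>l\<close> at the class of \<open>A\<close>. These are the matrix entries
  of the adjoint representation, and they generate the coordinate ring of \<open>PGL\<close>, that is, the
  degree 0 part of the coordinate ring of \<open>GL\<close>.\<close>

definition PGL_entry :: "'n \<Rightarrow> 'n \<Rightarrow> 'n \<Rightarrow> 'n \<Rightarrow> ('n::finite) pm \<Rightarrow> complex" where
  "PGL_entry i j k l x =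
     (THE c. \<forall>A\<in>hd x. c = matrix A $ i $ j * matrix_inv (matrix A) $ k $ l)"

inductive_set PGL_regular :: "(('n::finite) pm \<Rightarrow> complex) set" where
  const: "(\<lambda>x. c) \<in> PGL_regular"
| entry: "PGL_entry i j k l \<in> PGL_regular"
| add: "f \<in> PGL_regular \<Longrightarrow> g \<in> PGL_regular \<Longrightarrow> (\<lambda>x. f x + g x) \<in> PGL_regular"
| mult: "f \<in> PGL_regular \<Longrightarrow> g \<in> PGL_regular \<Longrightarrow> (\<lambda>x. f x * g x) \<in> PGL_regular"

definition Gm :: "complex monoid" where
  "Gm = \<lparr>carrier = UNIV - {0}, mult = (*), one = 1\<rparr>"

definition Gm_power :: "nat \<Rightarrow> (nat \<Rightarrow> complex) monoid" where
  "Gm_power k = product_group {..<k} (\<lambda>_. Gm)"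

inductive_set Gm_regular :: "nat \<Rightarrow> ((nat \<Rightarrow> complex) \<Rightarrow> complex) set" for k :: nat where
  const: "(\<lambda>z. c) \<in> Gm_regular k"
| coord: "i < k \<Longrightarrow> (\<lambda>z. z i) \<in> Gm_regular k"
| coord_inverse: "i < k \<Longrightarrow> (\<lambda>z. inverse (z i)) \<in> Gm_regular k"
| add: "f \<in> Gm_regular k \<Longrightarrow> g \<in> Gm_regular k \<Longrightarrow> (\<lambda>z. f z + g z) \<in> Gm_regular k"
| mult: "f \<in> Gm_regular k \<Longrightarrow> g \<in> Gm_regular k \<Longrightarrow> (\<lambda>z. f z * g z) \<in> Gm_regular k"

text \<open>A torus of \<open>PGL\<close> is a subgroup isomorphic, as an algebraic group, to a power of the
  multiplicative group. The first condition on \<open>f\<close> says that \<open>f\<close> is regular, the second one that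
  its inverse is: every regular function of \<open>z\<close> is the restriction of a regular function
  on \<open>PGL\<close>.\<close>

definition torus :: "('n::finite) pm set \<Rightarrow> bool" where
  "torus T \<longleftrightarrow> subgroup T PGL \<and>
     (\<exists>k f. f \<in> iso (Gm_power k) (PGL\<lparr>carrier := T\<rparr>) \<and>
        (\<forall>\<phi>\<in>PGL_regular. \<exists>\<psi>\<in>Gm_regular k. \<forall>z\<in>carrier (Gm_power k). \<phi> (f z) = \<psi> z) \<and>
        (\<forall>\<psi>\<in>Gm_regular k. \<exists>\<phi>\<in>PGL_regular. \<forall>z\<in>carrier (Gm_power k). \<phi> (f z) = \<psi> z))"

definition maximal_torus :: "('n::finite) pm set \<Rightarrow> bool" where
  "maximal_torus T \<longleftrightarrow> torus T \<and> (\<forall>T'. torus T' \<and> T \<subseteq> T' \<longrightarrow> T' = T)"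

text \<open>Bases of \<open>V\<close> are indexed by \<open>1, \<dots>, n\<close>; values of \<open>b\<close> at other indices are irrelevant.\<close>

definition is_basis :: "(nat \<Rightarrow> complex ^ 'n::finite) \<Rightarrow> bool" where
  "is_basis b \<longleftrightarrow> inj_on b {1..CARD('n)} \<and> vec.independent (b ` {1..CARD('n)}) \<and>
     vec.span (b ` {1..CARD('n)}) = UNIV"

definition diagonal_in :: "(nat \<Rightarrow> complex ^ 'n::finite) \<Rightarrow> 'n pm set \<Rightarrow> bool" where
  "diagonal_in b T \<longleftrightarrow> (\<forall>x\<in>T. \<forall>A\<in>hd x. \<forall>i\<in>{1..CARD('n)}. \<exists>c. A (b i) = c *s b i)"


section \<open>The monoid structure on the closure of the normalizer\<close>

text \<open>The Hermitian inner product making \<open>b\<close> orthonormal.\<close>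

definition herm ::
  "(nat \<Rightarrow> complex ^ 'n::finite) \<Rightarrow> complex ^ 'n \<Rightarrow> complex ^ 'n \<Rightarrow> complex" where
  "herm b v w = (\<Sum>i = 1..CARD('n).
     vec.representation (b ` {1..CARD('n)}) v (b i) *
     cnj (vec.representation (b ` {1..CARD('n)}) w (b i)))"

text \<open>The extension of \<open>A \<in> Hom W\<close> by 0 on the orthogonal complement of \<open>W\<close>: the composite of
  \<open>A\<close> with the orthogonal projection onto \<open>W\<close>.\<close>

definition extend ::
  "(nat \<Rightarrow> complex ^ 'n::finite) \<Rightarrow> (complex ^ 'n) set \<Rightarrow> (complex ^ 'n \<Rightarrow> complex ^ 'n) \<Rightarrow>
     complex ^ 'n \<Rightarrow> complex ^ 'n" where
  "extend b W A = (\<lambda>v. A (THE w. w \<in> W \<and> (\<forall>u\<in>W. herm b (v - w) u = 0)))"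

definition extend_all ::
  "(nat \<Rightarrow> complex ^ 'n::finite) \<Rightarrow> (complex ^ 'n \<Rightarrow> complex ^ 'n) list \<Rightarrow>
     (complex ^ 'n \<Rightarrow> complex ^ 'n) list" where
  "extend_all b As = map (\<lambda>i. extend b (common_ker As i) (As ! i)) [0..<length As]"

definition remove_redundant :: "('a \<Rightarrow> 'b::zero) list \<Rightarrow> ('a \<Rightarrow> 'b) list" where
  "remove_redundant L = nths L {k. \<not> common_ker L k \<subseteq> {v. (L ! k) v = 0}}"

text \<open>The product in \<open>End V\<close> is brought back to a sequence of maps on the successive kernels
  by restriction, which is inverse to extension by 0.\<close>

definition M_mult ::
  "(nat \<Rightarrow> complex ^ 'n::finite) \<Rightarrow> (complex ^ 'n \<Rightarrow> complex ^ 'n) list \<Rightarrow>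
     (complex ^ 'n \<Rightarrow> complex ^ 'n) list \<Rightarrow> (complex ^ 'n \<Rightarrow> complex ^ 'n) list" where
  "M_mult b As Bs =
     (let C = remove_redundant [A \<circ> B. B \<leftarrow> extend_all b Bs, A \<leftarrow> extend_all b As]
      in map (\<lambda>i. restr (common_ker C i) (C ! i)) [0..<length C])"

definition PM_mult :: "(nat \<Rightarrow> complex ^ 'n::finite) \<Rightarrow> 'n pm \<Rightarrow> 'n pm \<Rightarrow> 'n pm" where
  "PM_mult b x y = (THE z. \<exists>As\<in>M_set. \<exists>Bs\<in>M_set.
     map pclass As = x \<and> map pclass Bs = y \<and> z = map pclass (M_mult b As Bs))"

definition normalizer_closure ::
  "(nat \<Rightarrow> complex ^ 'n::finite) \<Rightarrow> 'n pm set \<Rightarrow> 'n pm monoid" where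
  "normalizer_closure b T =
     \<lparr>carrier = Abstract_Topology.closure_of PM_topology (normalizer PGL T), mult = PM_mult b, one = [pclass id]\<rparr>"

text \<open>\<open>FactGroup\<close> makes sense for any monoid: its elements are the orbits of (left)
  multiplication by \<open>T\<close>, multiplied as subsets, with unit \<open>T\<close>.\<close>

definition R_monoid :: "(nat \<Rightarrow> complex ^ 'n::finite) \<Rightarrow> 'n pm set \<Rightarrow> 'n pm set monoid" where
  "R_monoid b T = normalizer_closure b T Mod T"


section \<open>Ordered set partitions and matched pairs\<close>

definition P_monoid :: "nat \<Rightarrow> nat set list monoid" where
  "P_monoid n =
     \<lparr>carrier = {p. p \<noteq> [] \<and> distinct p \<and> partition_on {1..n} (set p)},
      mult = (\<lambda>p q. filter (\<lambda>X. X \<noteq> {}) [X \<inter> Y. Y \<leftarrow> q, X \<leftarrow> p]),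
      one = [{1..n}]\<rparr>"

definition matched_pair :: "'s monoid \<Rightarrow> 'b monoid \<Rightarrow> ('s \<times> 'b \<Rightarrow> 'b \<times> 's) \<Rightarrow> bool" where
  "matched_pair S B \<sigma> \<longleftrightarrow> monoid S \<and> monoid B \<and>
     \<sigma> \<in> carrier S \<times> carrier B \<rightarrow> carrier B \<times> carrier S \<and>
     (let l = (\<lambda>s b. fst (\<sigma> (s, b))); r = (\<lambda>s b. snd (\<sigma> (s, b))) in
       \<forall>s\<in>carrier S. \<forall>t\<in>carrier S. \<forall>b\<in>carrier B. \<forall>c\<in>carrier B.
         l s (l t b) = l (s \<otimes>\<^bsub>S\<^esub> t) b \<and>
         r (s \<otimes>\<^bsub>S\<^esub> t) b = r s (l t b) \<otimes>\<^bsub>S\<^esub> r t b \<and>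
         r (r s b) c = r s (b \<otimes>\<^bsub>B\<^esub> c) \<and>
         l s (b \<otimes>\<^bsub>B\<^esub> c) = l s b \<otimes>\<^bsub>B\<^esub> l (r s b) c \<and>
         l \<one>\<^bsub>S\<^esub> b = b \<and>
         l s \<one>\<^bsub>B\<^esub> = \<one>\<^bsub>B\<^esub> \<and>
         r s \<one>\<^bsub>B\<^esub> = s \<and>
         r \<one>\<^bsub>S\<^esub> b = \<one>\<^bsub>S\<^esub>)"

definition bicrossed_product ::
  "'b monoid \<Rightarrow> ('s \<times> 'b \<Rightarrow> 'b \<times> 's) \<Rightarrow> 's monoid \<Rightarrow> ('b \<times> 's) monoid" where
  "bicrossed_product B \<sigma> S =
     \<lparr>carrier = carrier B \<times> carrier S,
      mult = (\<lambda>(b, s) (c, t). (b \<otimes>\<^bsub>B\<^esub> fst (\<sigma> (s, c)), snd (\<sigma> (s, c)) \<otimes>\<^bsub>S\<^esub> t)),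
      one = (\<one>\<^bsub>B\<^esub>, \<one>\<^bsub>S\<^esub>)\<rparr>"

definition phi :: "nat set list \<times> (nat \<Rightarrow> nat) \<Rightarrow> (nat \<Rightarrow> nat) \<times> nat set list" where
  "phi = (\<lambda>(p, w). (w, map (\<lambda>X. inv' w ` X) p))"

end

theory Submission imports Defs
begin

text \<open>
  Everything takes place in the basis \<open>b\<close> that diagonalizes \<open>T\<close>. Write \<open>mon w u X\<close> for the map
  that sends \<open>b k\<close> to \<open>u k *s b (w k)\<close> for \<open>k \<in> X\<close> and kills the other basis vectors.

  The group \<open>T\<close> is the full group of diagonal classes: this group is itself a torus, and it
  contains \<open>T\<close>, so maximality forces equality (\<open>maximal_torus_eq_diagonal\<close>). Its normalizer consists
  of the classes of the monomial maps \<open>mon w u {1..n}\<close> with \<open>w\<close> a permutation, because an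
  invertible map that conjugates one diagonal map with distinct eigenvalues to a diagonal map must
  permute the coordinate lines (\<open>normalizer_diagonal\<close>).

  For an ordered partition \<open>p\<close> the maps \<open>mon w u (p ! i)\<close>, restricted to the successive common
  kernels, form an element \<open>mseq w u p\<close> of \<open>M\<close>. The classes of these sequences are the closure of
  the normalizer (\<open>closure_of_monomial_group\<close>). Each of them is a limit: scale the block \<open>p ! i\<close> of
  \<open>mon w u {1..n}\<close> by \<open>\<epsilon> ^ i\<close> and let \<open>\<epsilon>\<close> tend to 0; on the span of the blocks from \<open>i\<close> on, the
  block \<open>p ! i\<close> dominates. Conversely, let \<open>As\<close> be a sequence that is not of this form. Then for every
  permutation \<open>w\<close> some map of \<open>As\<close> sends some \<open>b k\<close> of its domain to a vector that
  has a nonzero coordinate outside the line of \<open>b (w k)\<close>. This is an open condition, and there are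
  only finitely many \<open>w\<close>, so a basic neighbourhood of \<open>As\<close> contains no monomial sequence.

  Since the common kernels are coordinate subspaces, extension by 0 on the orthogonal complement
  turns the sequence \<open>mseq w u p\<close> back into the list of the maps \<open>mon w u (p ! i)\<close>, and
  \<open>mon w u X \<circ> mon w' u' Y\<close> is monomial for \<open>w \<circ> w'\<close> with support \<open>w'\<^sup>-\<^sup>1(X) \<inter> Y\<close>. A product is
  redundant exactly when this support is empty. This is the product of the matched pair, with the
  coefficients multiplying along (\<open>M_mult_mseq\<close>). Multiplication by \<open>T\<close> changes
  the coefficients arbitrarily, so an orbit is determined by the pair \<open>(w, p)\<close>, and it
  determines this pair: \<open>p ! i\<close> is the set of those \<open>k\<close> for which the \<open>i\<close>-th map does not kill \<open>b k\<close>,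
  and \<open>w\<close> records the line in which the image of \<open>b k\<close> lies (\<open>mseq_inj\<close>).
\<close>

section \<open>Ordered set partitions\<close>

text \<open>The product of two ordered partitions before the empty intersections are removed. Working with
  this list first makes associativity a statement about nested lists, and removing the empty sets
  once at the end gives the same result as removing them at each step.\<close>
definition refine :: "'a set list \<Rightarrow> 'a set list \<Rightarrow> 'a set list" where
  "refine p q = [X \<inter> Y. Y \<leftarrow> q, X \<leftarrow> p]"

text \<open>Unlike distinctness together with disjointness of the set of blocks, this condition
  allows repeated empty sets, so it is stable under \<open>refine\<close>.\<close>
definition disjoint_list :: "'a set list \<Rightarrow> bool" where
  "disjoint_list = sorted_wrt (\<lambda>X Y. X \<inter> Y = {})"

lemma disjoint_list_nth:
  "disjoint_list L \<Longrightarrow> i < length L \<Longrightarrow> j < length L \<Longrightarrow> i \<noteq> j \<Longrightarrow> L ! i \<inter> L ! j = {}"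
  unfolding disjoint_list_def sorted_wrt_iff_nth_less
  by (metis Int_commute linorder_neqE_nat)

lemma disjoint_list_take:
  assumes "disjoint_list L" "i < length L"
  shows "L ! i \<inter> \<Union>(set (take i L)) = {}"
proof -
  have "L ! i \<inter> Y = {}" if Y: "Y \<in> set (take i L)" for Y
  proof -
    obtain j where "j < i" "Y = L ! j" using Y assms(2) by (auto simp: in_set_conv_nth)
    then show ?thesis using disjoint_list_nth[OF assms(1)] assms(2) by simp
  qed
  then show ?thesis by blast
qed

lemma P_carrier_iff:
  "p \<in> carrier (P_monoid n) \<longleftrightarrow> p \<noteq> [] \<and> disjoint_list p \<and> {} \<notin> set p \<and> \<Union>(set p) = {1..n}"
proof (intro iffI)
  assume p: "p \<in> carrier (P_monoid n)"
  have "p ! i \<inter> p ! j = {}" if "i < j" "j < length p" for i j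
    using p that by (auto simp: P_monoid_def partition_on_def disjoint_def distinct_conv_nth)
  then show "p \<noteq> [] \<and> disjoint_list p \<and> {} \<notin> set p \<and> \<Union>(set p) = {1..n}"
    using p by (auto simp: P_monoid_def partition_on_def disjoint_list_def sorted_wrt_iff_nth_less)
next
  assume p: "p \<noteq> [] \<and> disjoint_list p \<and> {} \<notin> set p \<and> \<Union>(set p) = {1..n}"
  then have dj: "i < length p \<Longrightarrow> j < length p \<Longrightarrow> i \<noteq> j \<Longrightarrow> p ! i \<inter> p ! j = {}" for i j
    using disjoint_list_nth by blast
  have "distinct p"
    unfolding distinct_conv_nth using dj p by (metis Int_absorb nth_mem)
  moreover have "disjoint (set p)"
    unfolding disjoint_def using dj by (metis in_set_conv_nth)
  ultimately show "p \<in> carrier (P_monoid n)"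
    using p by (auto simp: P_monoid_def partition_on_def)
qed

lemma disjoint_list_refine:
  assumes "disjoint_list p" "disjoint_list q"
  shows "disjoint_list (refine p q)"
  using assms(2)
proof (induction q)
  case (Cons Y q)
  have "sorted_wrt (\<lambda>X Z. X \<inter> Z = {}) (map (\<lambda>X. X \<inter> Y) p)"
    using assms(1) unfolding disjoint_list_def sorted_wrt_map
    by (rule sorted_wrt_mono_rel[rotated]) auto
  with Cons show ?case
    by (auto simp: disjoint_list_def refine_def sorted_wrt_append)
qed (simp add: refine_def disjoint_list_def)

lemma set_refine: "set (refine p q) = {X \<inter> Y | X Y. X \<in> set p \<and> Y \<in> set q}"
  by (auto simp: refine_def)

lemma Union_refine: "\<Union>(set (refine p q)) = \<Union>(set p) \<inter> \<Union>(set q)"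
  by (auto simp: refine_def)

abbreviation nonempties :: "'a set list \<Rightarrow> 'a set list" where
  "nonempties \<equiv> filter (\<lambda>X. X \<noteq> {})"

lemma P_mult: "p \<otimes>\<^bsub>P_monoid n\<^esub> q = nonempties (refine p q)"
  by (simp add: P_monoid_def refine_def)

lemma P_one: "\<one>\<^bsub>P_monoid n\<^esub> = [{1..n}]"
  by (simp add: P_monoid_def)

lemma refine_append: "refine p (q @ r) = refine p q @ refine p r"
  by (simp add: refine_def)

lemma refine_assoc: "refine (refine p q) r = refine p (refine q r)"
proof (induction r)
  case (Cons Z r)
  have "map (\<lambda>X. X \<inter> Z) (refine p q) = refine p (map (\<lambda>Y. Y \<inter> Z) q)"
    unfolding refine_def by (induction q) (auto simp: Int_assoc)
  then show ?case
    using Cons refine_append[of p "map (\<lambda>Y. Y \<inter> Z) q" "refine q r"]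
    by (simp add: refine_def)
qed (simp add: refine_def)

lemma nonempties_refine_left: "nonempties (refine (nonempties p) q) = nonempties (refine p q)"
proof (induction q)
  case (Cons Y q)
  have "nonempties (map (\<lambda>X. X \<inter> Y) (nonempties p)) = nonempties (map (\<lambda>X. X \<inter> Y) p)"
    by (induction p) auto
  then show ?case using Cons by (simp add: refine_def)
qed (simp add: refine_def)

lemma nonempties_refine_right: "nonempties (refine p (nonempties q)) = nonempties (refine p q)"
  by (induction q) (auto simp: refine_def)

lemma nonempties_id: "{} \<notin> set p \<Longrightarrow> nonempties p = p"
  by (induction p) auto

lemma P_mult_closed:
  assumes "n \<ge> 1" "p \<in> carrier (P_monoid n)" "q \<in> carrier (P_monoid n)"
  shows "nonempties (refine p q) \<in> carrier (P_monoid n)"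
proof -
  have "\<Union>(set (nonempties (refine p q))) = \<Union>(set (refine p q))" by auto
  then have U: "\<Union>(set (nonempties (refine p q))) = {1..n}"
    using assms by (simp add: Union_refine P_carrier_iff)
  then have ne: "nonempties (refine p q) \<noteq> []" using assms(1) by (metis Sup_empty atLeastatMost_empty_iff empty_set)
  have "disjoint_list (nonempties (refine p q))"
    using disjoint_list_refine[of p q] assms
    by (auto simp: P_carrier_iff disjoint_list_def intro: sorted_wrt_filter)
  then show ?thesis using U ne unfolding P_carrier_iff by auto
qed

lemma monoid_P_monoid:
  assumes "n \<ge> 1" shows "monoid (P_monoid n)"
proof (rule monoidI)
  show "\<one>\<^bsub>P_monoid n\<^esub> \<in> carrier (P_monoid n)"
    using assms by (auto simp: P_carrier_iff P_one disjoint_list_def)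
next
  fix p q assume "p \<in> carrier (P_monoid n)" "q \<in> carrier (P_monoid n)"
  then show "p \<otimes>\<^bsub>P_monoid n\<^esub> q \<in> carrier (P_monoid n)"
    using P_mult_closed[OF assms] by (simp add: P_mult)
next
  fix p q r
  show "p \<otimes>\<^bsub>P_monoid n\<^esub> q \<otimes>\<^bsub>P_monoid n\<^esub> r = p \<otimes>\<^bsub>P_monoid n\<^esub> (q \<otimes>\<^bsub>P_monoid n\<^esub> r)"
    by (simp add: P_mult nonempties_refine_left nonempties_refine_right refine_assoc)
next
  fix p assume p: "p \<in> carrier (P_monoid n)"
  then have sub: "\<forall>X\<in>set p. X \<subseteq> {1..n}" by (auto simp: P_carrier_iff)
  then have "refine [{1..n}] p = p" "refine p [{1..n}] = p"
    by (induction p) (auto simp: refine_def)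
  then show "\<one>\<^bsub>P_monoid n\<^esub> \<otimes>\<^bsub>P_monoid n\<^esub> p = p" "p \<otimes>\<^bsub>P_monoid n\<^esub> \<one>\<^bsub>P_monoid n\<^esub> = p"
    using p by (auto simp: P_mult P_one P_carrier_iff nonempties_id)
qed

lemma P_image_closed:
  assumes "w permutes {1..n}" "p \<in> carrier (P_monoid n)"
  shows "map ((`) w) p \<in> carrier (P_monoid n)"
proof -
  have "inj w" using assms(1) permutes_inj by blast
  then have "sorted_wrt (\<lambda>X Y. w ` X \<inter> w ` Y = {}) p"
    using assms(2) by (auto simp: P_carrier_iff disjoint_list_def image_Int[symmetric])
  moreover have "\<Union>(set (map ((`) w) p)) = w ` \<Union>(set p)" by auto
  ultimately show ?thesis
    using assms permutes_image[OF assms(1)]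
    by (auto simp: P_carrier_iff disjoint_list_def sorted_wrt_map)
qed

lemma image_refine: "inj w \<Longrightarrow> map ((`) w) (refine p q) = refine (map ((`) w) p) (map ((`) w) q)"
proof (induction q)
  case (Cons Y q)
  have "map (\<lambda>X. w ` X) (map (\<lambda>X. X \<inter> Y) p) = map (\<lambda>X. X \<inter> w ` Y) (map ((`) w) p)"
    using Cons by (simp add: image_Int)
  with Cons show ?case by (simp add: refine_def o_def)
qed (simp add: refine_def)

lemma nonempties_image: "map ((`) w) (nonempties p) = nonempties (map ((`) w) p)"
  by (induction p) auto

lemma phi_simps: "phi (p, w) = (w, map ((`) (inv' w)) p)"
  by (simp add: phi_def)

lemma matched_pair_phi:
  assumes "n \<ge> 1"
  shows "matched_pair (P_monoid n) (sym_group n) phi"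
proof -
  have one: "map ((`) (inv' w)) [{1..n}] = [{1..n}]" if "w permutes {1..n}" for w :: "nat \<Rightarrow> nat"
    using permutes_image[OF permutes_inv[OF that]] by simp
  have mult: "map ((`) (inv' w)) (p \<otimes>\<^bsub>P_monoid n\<^esub> q) =
      map ((`) (inv' w)) p \<otimes>\<^bsub>P_monoid n\<^esub> map ((`) (inv' w)) q" if "w permutes {1..n}" for w p q
    using permutes_inj[OF permutes_inv[OF that]] by (simp add: P_mult nonempties_image image_refine)
  have comp: "map ((`) (inv' w')) (map ((`) (inv' w)) p) = map ((`) (inv' (w \<circ> w'))) p"
    if "w permutes {1..n}" "w' permutes {1..n}" for w w' :: "nat \<Rightarrow> nat" and p
    using that by (simp add: o_inv_distrib permutes_bij image_comp)
  have im: "map ((`) (inv' w)) p \<in> carrier (P_monoid n)"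
    if "w permutes {1..n}" "p \<in> carrier (P_monoid n)" for w :: "nat \<Rightarrow> nat" and p
    using P_image_closed[OF permutes_inv[OF that(1)] that(2)] .
  have "monoid (sym_group n)" by (simp add: sym_group_is_group group.is_monoid)
  then show ?thesis
    unfolding matched_pair_def Let_def
    using monoid_P_monoid[OF assms] one mult comp im
    by (auto simp: phi_simps sym_group_carrier sym_group_mult sym_group_one P_one simp del: One_nat_def)
qed

text \<open>Associativity in the first component comes from the first and fourth axioms of a matched
  pair, in the second component from the second and third; the other axioms give the unit laws.\<close>
lemma monoid_bicrossed_product:
  assumes "matched_pair S B \<sigma>"
  shows "monoid (bicrossed_product B \<sigma> S)"
proof -
  interpret S: monoid S using assms by (simp add: matched_pair_def)
  interpret B: monoid B using assms by (simp add: matched_pair_def)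
  define l where "l = (\<lambda>s b. fst (\<sigma> (s, b)))"
  define r where "r = (\<lambda>s b. snd (\<sigma> (s, b)))"
  have cl: "l s b \<in> carrier B" "r s b \<in> carrier S" if "s \<in> carrier S" "b \<in> carrier B" for s b
  proof -
    have "\<sigma> \<in> carrier S \<times> carrier B \<rightarrow> carrier B \<times> carrier S"
      using assms unfolding matched_pair_def by (elim conjE)
    then have "\<sigma> (s, b) \<in> carrier B \<times> carrier S" using that by (auto dest: funcset_mem)
    then show "l s b \<in> carrier B" "r s b \<in> carrier S" by (auto simp: l_def r_def mem_Times_iff)
  qed
  have ax: "l s (l t b) = l (s \<otimes>\<^bsub>S\<^esub> t) b"
    "r (s \<otimes>\<^bsub>S\<^esub> t) b = r s (l t b) \<otimes>\<^bsub>S\<^esub> r t b"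
    "r (r s b) c = r s (b \<otimes>\<^bsub>B\<^esub> c)"
    "l s (b \<otimes>\<^bsub>B\<^esub> c) = l s b \<otimes>\<^bsub>B\<^esub> l (r s b) c"
    "l \<one>\<^bsub>S\<^esub> b = b" "l s \<one>\<^bsub>B\<^esub> = \<one>\<^bsub>B\<^esub>" "r s \<one>\<^bsub>B\<^esub> = s" "r \<one>\<^bsub>S\<^esub> b = \<one>\<^bsub>S\<^esub>"
    if "s \<in> carrier S" "t \<in> carrier S" "b \<in> carrier B" "c \<in> carrier B" for s t b c
    using assms that unfolding matched_pair_def Let_def l_def r_def by simp_all
  show ?thesis
  proof (rule monoidI, goal_cases)
    case (3 x y z)
    then obtain b s c t d q where xyz: "x = (b, s)" "y = (c, t)" "z = (d, q)"
      "b \<in> carrier B" "s \<in> carrier S" "c \<in> carrier B" "t \<in> carrier S" "d \<in> carrier B" "q \<in> carrier S"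
      by (auto simp: bicrossed_product_def)
    have "(b \<otimes>\<^bsub>B\<^esub> l s c) \<otimes>\<^bsub>B\<^esub> l (r s c \<otimes>\<^bsub>S\<^esub> t) d = b \<otimes>\<^bsub>B\<^esub> l s (c \<otimes>\<^bsub>B\<^esub> l t d)"
      using xyz(4-) by (simp add: cl ax[of s s c "l t d"] ax(1)[of "r s c" t d c, symmetric] B.m_assoc)
    moreover have "r (r s c \<otimes>\<^bsub>S\<^esub> t) d \<otimes>\<^bsub>S\<^esub> q = r s (c \<otimes>\<^bsub>B\<^esub> l t d) \<otimes>\<^bsub>S\<^esub> (r t d \<otimes>\<^bsub>S\<^esub> q)"
      using xyz(4-) by (simp add: cl ax(2)[of "r s c" t d c] ax(3)[of s s c "l t d"] S.m_assoc)
    ultimately show ?case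
      unfolding xyz by (simp add: bicrossed_product_def l_def r_def)
  next
    case 1 then show ?case using cl unfolding l_def r_def by (auto simp: bicrossed_product_def)
  next
    case (4 x) then show ?case
      using ax(5)[of "\<one>\<^bsub>S\<^esub>" "\<one>\<^bsub>S\<^esub>" "fst x" "fst x"] ax(8)[of "\<one>\<^bsub>S\<^esub>" "\<one>\<^bsub>S\<^esub>" "fst x" "fst x"]
      by (auto simp: bicrossed_product_def l_def r_def)
  next
    case (5 x) then show ?case
      using ax(6)[of "snd x" "snd x" "fst x" "fst x"] ax(7)[of "snd x" "snd x" "fst x" "fst x"]
      by (auto simp: bicrossed_product_def l_def r_def)
  qed (auto simp: bicrossed_product_def)
qed

section \<open>Sequences of maps and their scalar classes\<close>

lemma common_ker_eq: "common_ker L i = {v. \<forall>j<i. (L ! j) v = 0}"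
  by (induction i) (auto simp: less_Suc_eq)

lemma nths_within_length: "nths L {i. P i} = nths L {i. i < length L \<and> P i}"
  unfolding nths_def by (intro arg_cong[of _ _ "map fst"] filter_cong refl) (auto simp: set_zip)

text \<open>The passage from maps on the whole space back to maps on the successive kernels.\<close>
definition restrict_seq :: "('a \<Rightarrow> 'b::zero) list \<Rightarrow> ('a \<Rightarrow> 'b) list" where
  "restrict_seq L = map (\<lambda>i. restr (common_ker L i) (L ! i)) [0..<length L]"

lemma length_restrict_seq [simp]: "length (restrict_seq L) = length L"
  by (simp add: restrict_seq_def)

lemma restrict_seq_nth: "i < length L \<Longrightarrow> restrict_seq L ! i = restr (common_ker L i) (L ! i)"
  by (simp add: restrict_seq_def)

lemma common_ker_restrict_seq: "i \<le> length L \<Longrightarrow> common_ker (restrict_seq L) i = common_ker L i"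
  by (induction i) (auto simp: restrict_seq_nth restr_def)

lemma M_mult_eq:
  "M_mult b As Bs = restrict_seq (remove_redundant [A \<circ> B. B \<leftarrow> extend_all b Bs, A \<leftarrow> extend_all b As])"
  by (simp add: M_mult_def restrict_seq_def Let_def)

lemma pclass_self: "f \<in> pclass f"
  unfolding pclass_def by (rule CollectI, rule exI[of _ 1]) auto

lemma pclass_scale:
  assumes c: "c \<noteq> 0" shows "pclass (\<lambda>v. c *s f v) = pclass f"
proof (intro equalityI subsetI)
  fix g assume "g \<in> pclass (\<lambda>v. c *s f v)"
  then obtain d where "d \<noteq> 0" "g = (\<lambda>v. (d * c) *s f v)" by (auto simp: pclass_def)
  then show "g \<in> pclass f" unfolding pclass_def using c by (auto intro!: exI[of _ "d * c"])
next
  fix g assume "g \<in> pclass f"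
  then obtain d where "d \<noteq> 0" "g = (\<lambda>v. (d / c * c) *s f v)" using c by (auto simp: pclass_def)
  then show "g \<in> pclass (\<lambda>v. c *s f v)"
    unfolding pclass_def using c by (intro CollectI exI[of _ "d / c"]) auto
qed

lemma pclass_eq_iff: "pclass f = pclass g \<longleftrightarrow> (\<exists>c. c \<noteq> 0 \<and> g = (\<lambda>v. c *s f v))"
proof
  assume "pclass f = pclass g"
  then have "g \<in> pclass f" using pclass_self by blast
  then show "\<exists>c. c \<noteq> 0 \<and> g = (\<lambda>v. c *s f v)" unfolding pclass_def by auto
qed (auto simp: pclass_scale)

lemma Hom_UNIV_iff: "f \<in> Hom UNIV \<longleftrightarrow> Vector_Spaces.linear (*s) (*s) f"
  unfolding Hom_def Vector_Spaces.linear_iff by (auto simp: vec.vector_space_axioms)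

lemma Hom_add: "f \<in> Hom UNIV \<Longrightarrow> f (u + v) = f u + f v"
  and Hom_scale: "f \<in> Hom UNIV \<Longrightarrow> f (c *s v) = c *s f v"
  by (auto simp: Hom_def)

lemma Hom_zero: "f \<in> Hom UNIV \<Longrightarrow> f 0 = 0"
  using Hom_scale[of f 0 0] by simp

lemma Hom_sum: "f \<in> Hom UNIV \<Longrightarrow> f (sum g A) = (\<Sum>a\<in>A. f (g a))"
  by (induction A rule: infinite_finite_induct) (auto simp: Hom_add Hom_zero)

lemma Hom_comp: "f \<in> Hom UNIV \<Longrightarrow> g \<in> Hom UNIV \<Longrightarrow> f \<circ> g \<in> Hom UNIV"
  by (auto simp: Hom_def)

lemma Hom_smult: "f \<in> Hom UNIV \<Longrightarrow> (\<lambda>v. c *s f v) \<in> Hom UNIV"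
  by (auto simp: Hom_def vec.scale_right_distrib)

section \<open>The projective linear group and its regular functions\<close>

lemma Hom_axis_expansion: "f \<in> Hom UNIV \<Longrightarrow> f v = (\<Sum>s\<in>UNIV. v $ s *s f (axis s 1))"
  using Hom_sum[of f "\<lambda>s. v $ s *s axis s 1" UNIV] by (simp add: Hom_scale basis_expansion)

lemma matrix_inv_eq:
  assumes "A ** B = mat 1" "B ** A = mat 1"
  shows "matrix_inv A = B"
proof -
  have "A ** matrix_inv A = mat 1 \<and> matrix_inv A ** A = mat 1"
    unfolding matrix_inv_def using assms by (intro someI[of "\<lambda>X. A ** X = mat 1 \<and> X ** A = mat 1"]) auto
  then have "matrix_inv A = (B ** A) ** matrix_inv A" "A ** matrix_inv A = mat 1" using assms by auto
  then show ?thesis by (metis matrix_mul_assoc matrix_mul_rid)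
qed

text \<open>The scalar by which a representative of the class is multiplied cancels against its inverse in
  the inverse matrix, so the entry function may be computed on any representative.\<close>
lemma PGL_entry_eq:
  assumes A: "A \<in> Hom UNIV" and B: "B \<in> Hom UNIV" and AB: "A \<circ> B = id" and BA: "B \<circ> A = id"
  shows "PGL_entry i j k l [pclass A] = A (axis j 1) $ i * B (axis l 1) $ k"
proof -
  have "matrix A' $ i $ j * matrix_inv (matrix A') $ k $ l = A (axis j 1) $ i * B (axis l 1) $ k"
    if A': "A' \<in> pclass A" for A'
  proof -
    obtain c where c: "c \<noteq> 0" "A' = (\<lambda>v. c *s A v)" using A' by (auto simp: pclass_def)
    define B' where "B' = (\<lambda>v. inverse c *s B v)"
    have lin: "Vector_Spaces.linear (*s) (*s) A'" "Vector_Spaces.linear (*s) (*s) B'"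
      using A B by (auto simp: c(2) B'_def Hom_smult simp flip: Hom_UNIV_iff)
    have "A' \<circ> B' = id" "B' \<circ> A' = id"
      using AB BA c(1) by (auto simp: c(2) B'_def fun_eq_iff Hom_scale[OF A] Hom_scale[OF B])
    then have "matrix A' ** matrix B' = mat 1" "matrix B' ** matrix A' = mat 1"
      using matrix_compose_gen[OF lin(2) lin(1)] matrix_compose_gen[OF lin(1) lin(2)]
      by (simp_all add: matrix_id_mat_1)
    then have "matrix_inv (matrix A') = matrix B'" by (rule matrix_inv_eq)
    then show ?thesis using c(1) by (simp add: matrix_def c(2) B'_def)
  qed
  moreover have "hd [pclass A] = pclass A" by simp
  ultimately show ?thesis
    unfolding PGL_entry_def using pclass_self[of A] by (intro the_equality) auto
qed

lemma PGL_regular_sum: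
  "(\<And>a. a \<in> A \<Longrightarrow> f a \<in> PGL_regular) \<Longrightarrow> (\<lambda>x. \<Sum>a\<in>A. f a x) \<in> PGL_regular"
  by (induction A rule: infinite_finite_induct) (auto intro: PGL_regular.intros)

lemma Gm_regular_sum:
  "(\<And>a. a \<in> A \<Longrightarrow> f a \<in> Gm_regular k) \<Longrightarrow> (\<lambda>x. \<Sum>a\<in>A. f a x) \<in> Gm_regular k"
  by (induction A rule: infinite_finite_induct) (auto intro: Gm_regular.intros)

lemma PGL_mult:
  assumes "A \<in> Hom UNIV"
  shows "[pclass A] \<otimes>\<^bsub>PGL\<^esub> [pclass B] = [pclass (A \<circ> B)]"
proof -
  have "{A' \<circ> B' | A' B'. A' \<in> pclass A \<and> B' \<in> pclass B} = pclass (A \<circ> B)"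
  proof (intro equalityI subsetI)
    fix f assume "f \<in> {A' \<circ> B' | A' B'. A' \<in> pclass A \<and> B' \<in> pclass B}"
    then obtain c d where "c \<noteq> 0" "d \<noteq> 0" "f = (\<lambda>v. c *s A v) \<circ> (\<lambda>v. d *s B v)"
      by (auto simp: pclass_def)
    then show "f \<in> pclass (A \<circ> B)"
      by (auto simp: pclass_def Hom_scale[OF assms] intro!: exI[of _ "c * d"])
  next
    fix f assume "f \<in> pclass (A \<circ> B)"
    then obtain c where "c \<noteq> 0" "f = (\<lambda>v. c *s A v) \<circ> B" by (auto simp: pclass_def o_def)
    moreover from this have "(\<lambda>v. c *s A v) \<in> pclass A" by (auto simp: pclass_def)
    ultimately show "f \<in> {A' \<circ> B' | A' B'. A' \<in> pclass A \<and> B' \<in> pclass B}"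
      using pclass_self[of B] by blast
  qed
  then show ?thesis by (simp add: PGL_def)
qed

lemma PGL_one: "\<one>\<^bsub>PGL\<^esub> = [pclass id]"
  by (simp add: PGL_def)

lemma PGL_carrier:
  "carrier PGL = {[pclass A] | A :: complex ^ 'n::finite \<Rightarrow> complex ^ 'n. A \<in> Hom UNIV \<and> inj A}"
proof -
  have inj: "inj A \<longleftrightarrow> {v. A v = 0} = {0}" if A: "A \<in> Hom UNIV" for A :: "complex ^ 'n \<Rightarrow> complex ^ 'n"
  proof
    assume "{v. A v = 0} = {0}"
    moreover have "A (x - y) = A x - A y" for x y
      using Hom_add[OF A, of "x - y" y] by simp
    ultimately show "inj A" by (intro injI) (metis (mono_tags, lifting) eq_iff_diff_eq_0 mem_Collect_eq singletonD)
  qed (use Hom_zero[OF A] in \<open>auto simp: inj_def\<close>)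
  have nz: "A \<noteq> (\<lambda>v. 0)" if "inj A" for A :: "complex ^ 'n \<Rightarrow> complex ^ 'n"
    using that injD[OF that, of 0 "axis undefined 1"] by (auto simp: axis_eq_0_iff)
  show ?thesis
  proof (intro equalityI subsetI)
    fix x :: "'n pm" assume "x \<in> carrier PGL"
    then obtain As where As: "As \<in> M_set" "x = map pclass As" "length As = 1"
      by (auto simp: PGL_def PM_def)
    then obtain A where "As = [A]" by (auto simp: length_Suc_conv)
    then show "x \<in> {[pclass A] | A. A \<in> Hom UNIV \<and> inj A}"
      using As inj[of A] by (auto simp: M_set_def Hom_nonzero_def)
  next
    fix x :: "'n pm" assume "x \<in> {[pclass A] | A. A \<in> Hom UNIV \<and> inj A}"
    then obtain A where A: "x = [pclass A]" "A \<in> Hom UNIV" "inj A" by blast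
    then have "[A] \<in> M_set" using inj nz by (simp add: M_set_def Hom_nonzero_def)
    then show "x \<in> carrier PGL" using A by (force simp: PGL_def PM_def)
  qed
qed

lemma group_PGL: "group (PGL :: ('n::finite) pm monoid)"
proof (rule groupI)
  fix x y :: "'n pm" assume "x \<in> carrier PGL" "y \<in> carrier PGL"
  then show "x \<otimes>\<^bsub>PGL\<^esub> y \<in> carrier PGL"
    by (auto simp: PGL_carrier PGL_mult) (use Hom_comp inj_compose in blast)
next
  have "(id :: complex ^ 'n \<Rightarrow> complex ^ 'n) \<in> Hom UNIV" by (simp add: Hom_def)
  then show "\<one>\<^bsub>PGL :: 'n pm monoid\<^esub> \<in> carrier PGL" using inj_on_id unfolding PGL_carrier PGL_one by blast
next
  fix x y z :: "'n pm" assume "x \<in> carrier PGL" "y \<in> carrier PGL" "z \<in> carrier PGL"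
  then show "x \<otimes>\<^bsub>PGL\<^esub> y \<otimes>\<^bsub>PGL\<^esub> z = x \<otimes>\<^bsub>PGL\<^esub> (y \<otimes>\<^bsub>PGL\<^esub> z)"
    by (auto simp: PGL_carrier PGL_mult Hom_comp o_assoc)
next
  have id: "(id :: complex ^ 'n \<Rightarrow> complex ^ 'n) \<in> Hom UNIV" by (simp add: Hom_def)
  fix x :: "'n pm" assume "x \<in> carrier PGL"
  then obtain A where A: "x = [pclass A]" "A \<in> Hom UNIV" "inj A" by (auto simp: PGL_carrier)
  then show "\<one>\<^bsub>PGL\<^esub> \<otimes>\<^bsub>PGL\<^esub> x = x" by (simp add: PGL_one PGL_mult[OF id])
  have "Vector_Spaces.linear (*s) (*s) A" using A by (simp add: Hom_UNIV_iff)
  then obtain B where B: "Vector_Spaces.linear (*s) (*s) B" "B \<circ> A = id" "A \<circ> B = id"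
    using vec.linear_injective_isomorphism[of A] A(3) by (auto simp: fun_eq_iff)
  then have "B \<in> Hom UNIV" "inj B" by (auto simp: Hom_UNIV_iff intro: inj_on_imageI2 dest: pointfree_idE intro!: inj_on_inverseI[of _ A])
  then show "\<exists>y\<in>carrier PGL. y \<otimes>\<^bsub>PGL\<^esub> x = \<one>\<^bsub>PGL\<^esub>"
    using B A by (intro bexI[of _ "[pclass B]"]) (auto simp: PGL_one PGL_mult PGL_carrier)
qed

lemma (in group) mem_normalizer_iff:
  assumes "H \<subseteq> carrier G"
  shows "g \<in> normalizer G H \<longleftrightarrow> g \<in> carrier G \<and> (\<lambda>h. g \<otimes> h \<otimes> inv g) ` H = H"
proof -
  have "g <# H #> inv g = (\<lambda>h. g \<otimes> h \<otimes> inv g) ` H"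
    by (auto simp: l_coset_def r_coset_def)
  then show ?thesis using assms by (simp add: normalizer_def stabilizer_def)
qed

text \<open>A bijection from a monoid that respects products and units carries the monoid laws along; in
  this way the quotient by the torus is seen to be a monoid without computing in it.\<close>
lemma monoid_iso_transport:
  assumes B: "monoid B" and bij: "bij_betw F (carrier B) (carrier R)"
    and mult: "\<And>x y. x \<in> carrier B \<Longrightarrow> y \<in> carrier B \<Longrightarrow> F (x \<otimes>\<^bsub>B\<^esub> y) = F x \<otimes>\<^bsub>R\<^esub> F y"
    and one: "F \<one>\<^bsub>B\<^esub> = \<one>\<^bsub>R\<^esub>"
  shows "monoid R \<and> (\<exists>h\<in>iso R B. h \<one>\<^bsub>R\<^esub> = \<one>\<^bsub>B\<^esub>)"
proof -
  interpret B: monoid B by fact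
  have R: "carrier R = F ` carrier B" and inj: "inj_on F (carrier B)" using bij by (auto simp: bij_betw_def)
  have "monoid R"
    by (rule monoidI) (auto simp: R B.m_assoc simp flip: mult one)
  moreover define h where "h = inv_into (carrier B) F"
  have h: "h (F x) = x" if "x \<in> carrier B" for x using that inj by (simp add: h_def)
  have "h \<in> hom R B" by (auto simp: hom_def R h simp flip: mult)
  moreover have "bij_betw h (carrier R) (carrier B)" unfolding h_def by (rule bij_betw_inv_into[OF bij])
  moreover have "h \<one>\<^bsub>R\<^esub> = \<one>\<^bsub>B\<^esub>" using h[of "\<one>\<^bsub>B\<^esub>"] one by simp
  ultimately show ?thesis by (auto simp: iso_def)
qed

section \<open>Monomial maps in a basis\<close>

locale framed =
  fixes n :: nat and b :: "nat \<Rightarrow> complex ^ 'n::finite"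
  assumes card: "CARD('n) = n" and basis: "is_basis b"
begin

(* The index set {1..n} is kept opaque for the simplifier. *)
declare One_nat_def [simp del] atLeastAtMost_iff [simp del]

abbreviation I :: "nat set" where "I \<equiv> {1..n}"

abbreviation OP :: "nat set list set" where "OP \<equiv> carrier (P_monoid n)"

definition crd :: "nat \<Rightarrow> complex ^ 'n \<Rightarrow> complex" where
  "crd j v = vec.representation (b ` I) v (b j)"

lemma inj_b: "inj_on b I" and indep: "vec.independent (b ` I)" and spans: "vec.span (b ` I) = UNIV"
  using basis by (auto simp: is_basis_def card)

lemma crd_add: "crd j (u + v) = crd j u + crd j v"
  by (simp add: crd_def vec.representation_add indep spans)

lemma crd_scale: "crd j (c *s v) = c * crd j v"
  by (simp add: crd_def vec.representation_scale indep spans)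

lemma crd_diff: "crd j (u - v) = crd j u - crd j v"
  by (simp add: crd_def vec.representation_diff indep spans)

lemma crd_zero [simp]: "crd j 0 = 0"
  by (simp add: crd_def vec.representation_zero)

lemma crd_sum: "crd j (sum f A) = (\<Sum>a\<in>A. crd j (f a))"
  by (induction A rule: infinite_finite_induct) (auto simp: crd_add)

lemma crd_basis: "j \<in> I \<Longrightarrow> k \<in> I \<Longrightarrow> crd j (b k) = (if j = k then 1 else 0)"
  using inj_b by (simp add: crd_def vec.representation_basis[OF indep] inj_on_eq_iff)

lemma expand: "(\<Sum>j\<in>I. crd j v *s b j) = v"
proof -
  have "(\<Sum>x\<in>b ` I. vec.representation (b ` I) v x *s x) = v"
    using indep spans by (intro vec.sum_representation_eq) auto
  then show ?thesis
    by (subst (asm) sum.reindex[OF inj_b]) (simp add: crd_def o_def)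
qed

lemma crd_eqI:
  assumes "\<And>j. j \<in> I \<Longrightarrow> crd j u = crd j v"
  shows "u = v"
proof -
  have "(\<Sum>j\<in>I. crd j u *s b j) = (\<Sum>j\<in>I. crd j v *s b j)"
    using assms by (intro sum.cong refl) simp
  then show ?thesis by (simp only: expand)
qed

lemma b_nonzero: "k \<in> I \<Longrightarrow> b k \<noteq> 0"
  using crd_basis[of k k] by auto

lemma continuous_crd: "continuous_on UNIV (crd j)"
proof -
  have "crd j (r *\<^sub>R v) = r *\<^sub>R crd j v" for r v
  proof -
    have "r *\<^sub>R v = complex_of_real r *s v"
      by (simp add: vec_eq_iff) (simp add: scaleR_conv_of_real)
    then show ?thesis by (simp add: crd_scale scaleR_conv_of_real)
  qed
  then have "linear (crd j)" by (intro linearI) (auto simp: crd_add)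
  then show ?thesis by (simp add: linear_continuous_on linear_conv_bounded_linear)
qed

lemma Hom_eqI:
  assumes "f \<in> Hom UNIV" "g \<in> Hom UNIV" "\<And>k. k \<in> I \<Longrightarrow> f (b k) = g (b k)"
  shows "f = g"
proof
  fix v
  have "f (\<Sum>j\<in>I. crd j v *s b j) = g (\<Sum>j\<in>I. crd j v *s b j)"
    using assms by (simp add: Hom_sum Hom_scale)
  then show "f v = g v" by (simp only: expand)
qed

definition mon :: "(nat \<Rightarrow> nat) \<Rightarrow> (nat \<Rightarrow> complex) \<Rightarrow> nat set \<Rightarrow> complex ^ 'n \<Rightarrow> complex ^ 'n" where
  "mon w u X v = (\<Sum>k\<in>X. (crd k v * u k) *s b (w k))"

abbreviation nonzero :: "(nat \<Rightarrow> complex) \<Rightarrow> bool" where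
  "nonzero u \<equiv> (\<forall>k\<in>I. u k \<noteq> 0)"

lemma mon_Hom: "mon w u X \<in> Hom UNIV"
  by (auto simp: Hom_def mon_def crd_add crd_scale distrib_right vec.scale_left_distrib
      sum.distrib vec.scale_sum_right mult.assoc)

lemma mon_basis:
  assumes "X \<subseteq> I" "k \<in> I"
  shows "mon w u X (b k) = (if k \<in> X then u k *s b (w k) else 0)"
proof -
  have "finite X" using assms(1) finite_subset by blast
  have "mon w u X (b k) = (\<Sum>j\<in>X. if j = k then u k *s b (w k) else 0)"
    unfolding mon_def using assms by (intro sum.cong refl) (auto simp: crd_basis subset_iff)
  then show ?thesis using \<open>finite X\<close> by simp
qed

text \<open>The vectors \<open>b (w k)\<close> are again part of the basis, so the coordinates of an image under a
  monomial map do not mix. This separation of coordinates gives the kernels of monomial maps.\<close>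
lemma crd_mon:
  assumes w: "w permutes I" and "X \<subseteq> I" "k \<in> I"
  shows "crd (w k) (mon w u X v) = (if k \<in> X then crd k v * u k else 0)"
proof -
  have "finite X" using assms(2) finite_subset by blast
  have *: "crd (w k) (b (w j)) = (if j = k then 1 else 0)" if "j \<in> X" for j
  proof -
    have "w k \<in> I" "w j \<in> I" using that assms permutes_in_image[OF w] by blast+
    then show ?thesis using permutes_inj[OF w] by (auto simp: crd_basis inj_eq)
  qed
  have "crd (w k) (mon w u X v) = (\<Sum>j\<in>X. if j = k then crd k v * u k else 0)"
    unfolding mon_def crd_sum crd_scale by (intro sum.cong refl) (simp add: *)
  then show ?thesis using \<open>finite X\<close> by simp
qed

lemma mon_eq_0_iff:
  assumes w: "w permutes I" and "nonzero u" and "X \<subseteq> I"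
  shows "mon w u X v = 0 \<longleftrightarrow> (\<forall>k\<in>X. crd k v = 0)"
proof
  assume "mon w u X v = 0"
  then have "crd k v * u k = 0" if "k \<in> X" for k
    using crd_mon[OF w assms(3), of k u v] that assms(3) by auto
  then show "\<forall>k\<in>X. crd k v = 0" using assms by auto
qed (simp add: mon_def)

text \<open>Under the composite \<open>b k\<close> survives iff \<open>k\<close> lies in \<open>Y\<close> and \<open>w' k\<close> lies in \<open>X\<close>. This is the origin of the
  action of a permutation on the blocks in the matched pair.\<close>
lemma mon_comp:
  assumes w: "w permutes I" and w': "w' permutes I" and "X \<subseteq> I" "Y \<subseteq> I"
  shows "mon w u X \<circ> mon w' u' Y = mon (w \<circ> w') (\<lambda>k. u (w' k) * u' k) (inv' w' ` X \<inter> Y)"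
proof (rule Hom_eqI)
  fix k assume k: "k \<in> I"
  have "w' k \<in> I" using k permutes_in_image[OF w'] by blast
  moreover have "k \<in> inv' w' ` X \<longleftrightarrow> w' k \<in> X"
    using permutes_inverses[OF w'] by (metis imageE imageI)
  moreover have "inv' w' ` X \<inter> Y \<subseteq> I" using assms by auto
  ultimately show "(mon w u X \<circ> mon w' u' Y) (b k) =
      mon (w \<circ> w') (\<lambda>k. u (w' k) * u' k) (inv' w' ` X \<inter> Y) (b k)"
    using k assms by (simp add: mon_basis Hom_scale[OF mon_Hom] Hom_zero[OF mon_Hom] mult.commute)
qed (intro Hom_comp mon_Hom)+

text \<open>The span of the basis vectors with index outside \<open>S\<close>; it is described by equations because it
  arises as a common kernel.\<close>
definition vanish :: "nat set \<Rightarrow> (complex ^ 'n) set" where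
  "vanish S = {v. \<forall>k\<in>S. crd k v = 0}"

lemma basis_in_vanish: "S \<subseteq> I \<Longrightarrow> k \<in> I \<Longrightarrow> b k \<in> vanish S \<longleftrightarrow> k \<notin> S"
  by (auto simp: vanish_def crd_basis subset_iff)

lemma vanish_I: "vanish I = {0}"
  by (auto simp: vanish_def intro: crd_eqI)

lemma common_ker_mon:
  assumes "w permutes I" "nonzero u" "\<Union>(set p) \<subseteq> I" "i \<le> length p"
  shows "common_ker (map (mon w u) p) i = vanish (\<Union>(set (take i p)))"
  using assms(4)
proof (induction i)
  case (Suc i)
  have "p ! i \<subseteq> I" using assms(3) Suc.prems by (metis Sup_le_iff Suc_le_eq nth_mem)
  then show ?case using Suc mon_eq_0_iff[OF assms(1,2)]
    by (auto simp: vanish_def take_Suc_conv_app_nth)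
qed (simp add: vanish_def)

definition mseq :: "(nat \<Rightarrow> nat) \<Rightarrow> (nat \<Rightarrow> complex) \<Rightarrow> nat set list \<Rightarrow> (complex ^ 'n \<Rightarrow> complex ^ 'n) list" where
  "mseq w u p = restrict_seq (map (mon w u) p)"

lemma OP_D:
  assumes "p \<in> OP"
  shows "p \<noteq> []" "\<Union>(set p) = I" "{} \<notin> set p" "disjoint_list p"
    "\<And>i. i < length p \<Longrightarrow> p ! i \<subseteq> I" "\<And>i. \<Union>(set (take i p)) \<subseteq> I"
    "\<And>i. i < length p \<Longrightarrow> p ! i \<inter> \<Union>(set (take i p)) = {}"
proof -
  show *: "p \<noteq> []" "\<Union>(set p) = I" "{} \<notin> set p" "disjoint_list p"
    using assms by (auto simp: P_carrier_iff)
  show "p ! i \<subseteq> I" if "i < length p" for i using that *(2) nth_mem by blast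
  show "\<Union>(set (take i p)) \<subseteq> I" for i using *(2) set_take_subset[of i p] by blast
  show "p ! i \<inter> \<Union>(set (take i p)) = {}" if "i < length p" for i
    using disjoint_list_take[OF *(4) that] .
qed

lemma length_mseq [simp]: "length (mseq w u p) = length p"
  by (simp add: mseq_def)

context
  fixes w :: "nat \<Rightarrow> nat" and u :: "nat \<Rightarrow> complex" and p :: "nat set list"
  assumes w: "w permutes I" and u: "nonzero u" and p: "p \<in> OP"
begin

lemma common_ker_mseq: "i \<le> length p \<Longrightarrow> common_ker (mseq w u p) i = vanish (\<Union>(set (take i p)))"
  using common_ker_mon[OF w u] OP_D(2)[OF p]
  by (simp add: mseq_def common_ker_restrict_seq)

lemma mseq_nth: "i < length p \<Longrightarrow> mseq w u p ! i = restr (vanish (\<Union>(set (take i p)))) (mon w u (p ! i))"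
  using common_ker_mon[OF w u, of p i] OP_D(2)[OF p]
  by (simp add: mseq_def restrict_seq_nth)

lemma mseq_basis:
  assumes i: "i < length p" and k: "k \<in> I"
  shows "(mseq w u p ! i) (b k) = (if k \<in> p ! i then u k *s b (w k) else 0)"
proof -
  have "k \<in> p ! i \<Longrightarrow> b k \<in> vanish (\<Union>(set (take i p)))"
    using OP_D(7)[OF p i] basis_in_vanish[OF OP_D(6)[OF p, of i] k] by blast
  then show ?thesis using mon_basis[OF OP_D(5)[OF p i] k] by (auto simp: mseq_nth[OF i] restr_def)
qed

lemma mseq_in_M: "mseq w u p \<in> M_set"
proof -
  have "mseq w u p ! i \<in> Hom_nonzero (common_ker (mseq w u p) i)" if i: "i < length p" for i
  proof -
    have "p ! i \<noteq> {}" using OP_D(3)[OF p] i by (metis nth_mem)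
    then obtain k where k: "k \<in> p ! i" "k \<in> I" using OP_D(5)[OF p i] by blast
    then have "(mseq w u p ! i) (b k) \<noteq> 0"
      using u b_nonzero permutes_in_image[OF w, of k] i
      by (auto simp: mseq_basis vec.scale_eq_0_iff)
    then have "mseq w u p ! i \<noteq> (\<lambda>v. 0)" by auto
    moreover have "mseq w u p ! i \<in> Hom (vanish (\<Union>(set (take i p))))"
      unfolding mseq_nth[OF i] Hom_def restr_def
      by (auto simp: Hom_add[OF mon_Hom] Hom_scale[OF mon_Hom] vanish_def crd_add crd_scale)
    ultimately show ?thesis using i by (simp add: Hom_nonzero_def common_ker_mseq)
  qed
  moreover have "common_ker (mseq w u p) (length p) = {0}"
    using OP_D(2)[OF p] vanish_I by (simp add: common_ker_mseq)
  moreover have "mseq w u p \<noteq> []" using OP_D(1)[OF p] by (metis length_0_conv length_mseq)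
  ultimately show ?thesis by (simp add: M_set_def)
qed

text \<open>The basis is orthonormal for \<open>herm\<close>, hence the orthogonal projection onto a coordinate subspace
  only drops coordinates. The dropped ones belong to earlier blocks, on which \<open>mon w u (p ! i)\<close>
  vanishes anyway.\<close>
lemma extend_all_mseq: "extend_all b (mseq w u p) = map (mon w u) p"
proof (rule nth_equalityI)
  fix i assume "i < length (extend_all b (mseq w u p))"
  then have i: "i < length p" by (simp add: extend_all_def)
  define S where "S = \<Union>(set (take i p))"
  have S: "S \<subseteq> I" "p ! i \<inter> S = {}" using OP_D(6,7)[OF p] i by (auto simp: S_def)
  have "extend b (vanish S) (restr (vanish S) (mon w u (p ! i))) v = mon w u (p ! i) v" for v
  proof -
    define z where "z = mon id (\<lambda>_. 1) (I - S) v"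
    have z: "crd k z = (if k \<in> S then 0 else crd k v)" if "k \<in> I" for k
      using crd_mon[OF permutes_id, of "I - S" k] that by (auto simp: z_def)
    have zv: "z \<in> vanish S" using S z by (auto simp: vanish_def)
    have herm: "herm b x y = (\<Sum>k\<in>I. crd k x * cnj (crd k y))" for x y
      by (simp add: herm_def crd_def card)
    have "(THE y. y \<in> vanish S \<and> (\<forall>x\<in>vanish S. herm b (v - y) x = 0)) = z"
    proof (rule the_equality)
      have "crd k (v - z) * cnj (crd k x) = 0" if "x \<in> vanish S" "k \<in> I" for x k
        using that by (auto simp: z crd_diff vanish_def)
      then show "z \<in> vanish S \<and> (\<forall>x\<in>vanish S. herm b (v - z) x = 0)"
        using zv by (auto simp: herm intro!: sum.neutral)
    next
      fix y assume y: "y \<in> vanish S \<and> (\<forall>x\<in>vanish S. herm b (v - y) x = 0)"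
      have "crd k y = crd k z" if k: "k \<in> I" for k
      proof (cases "k \<in> S")
        case False
        then have "herm b (v - y) (b k) = 0" using y k S basis_in_vanish by blast
        moreover have "herm b (v - y) (b k) = (\<Sum>j\<in>I. if j = k then crd k (v - y) else 0)"
          unfolding herm using k by (intro sum.cong refl) (simp add: crd_basis)
        ultimately have "crd k (v - y) = 0" using k by simp
        then show ?thesis using False k by (simp add: z crd_diff)
      qed (use y z k in \<open>auto simp: vanish_def\<close>)
      then show "y = z" by (rule crd_eqI)
    qed
    then have "extend b (vanish S) (restr (vanish S) (mon w u (p ! i))) v = mon w u (p ! i) z"
      using zv by (simp add: extend_def restr_def)
    also have "\<dots> = mon w u (p ! i) v"
      unfolding mon_def using S z OP_D(5)[OF p i] by (intro sum.cong refl) (auto simp: disjoint_iff subset_iff)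
    finally show ?thesis .
  qed
  then show "extend_all b (mseq w u p) ! i = map (mon w u) p ! i"
    using i by (simp add: extend_all_def common_ker_mseq mseq_nth S_def fun_eq_iff)
qed (simp add: extend_all_def)

end

text \<open>A basis vector in a block is killed by all maps of the other blocks, so it witnesses
  that the map of a nonempty block is not redundant.\<close>
lemma remove_redundant_mon:
  assumes w: "w permutes I" and u: "nonzero u" and L: "\<Union>(set L) \<subseteq> I" "disjoint_list L"
  shows "remove_redundant (map (mon w u) L) = map (mon w u) (nonempties L)"
proof -
  have "\<not> common_ker (map (mon w u) L) i \<subseteq> {v. (map (mon w u) L ! i) v = 0} \<longleftrightarrow> L ! i \<noteq> {}"
    if i: "i < length L" for i
  proof (cases "L ! i = {}")
    case False
    then obtain k where k: "k \<in> L ! i" by blast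
    have Li: "L ! i \<subseteq> I" using L(1) i nth_mem by blast
    have ki: "k \<in> I" using Li k by blast
    have "\<Union>(set (take i L)) \<subseteq> I" using L(1) set_take_subset[of i L] by blast
    moreover have "k \<notin> \<Union>(set (take i L))"
      using disjoint_list_take[OF L(2) i] k by blast
    ultimately have "b k \<in> common_ker (map (mon w u) L) i"
      using common_ker_mon[OF w u L(1), of i] i basis_in_vanish ki by simp
    moreover have "mon w u (L ! i) (b k) \<noteq> 0"
      using mon_eq_0_iff[OF w u Li] k crd_basis[OF ki ki] by force
    ultimately show ?thesis using i False by auto
  qed (use i in \<open>auto simp: mon_def\<close>)
  note * = this
  have "remove_redundant (map (mon w u) L) = nths (map (mon w u) L) {i. i < length L \<and> L ! i \<noteq> {}}"
    unfolding remove_redundant_def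
    by (subst nths_within_length, rule arg_cong[of _ _ "nths _"], rule Collect_cong)
      (use * in \<open>simp only: length_map cong: conj_cong\<close>)
  also have "\<dots> = map (mon w u) (nonempties L)"
    by (simp add: nths_map filter_eq_nths)
  finally show ?thesis .
qed

lemma M_mult_mseq:
  assumes w: "w permutes I" and u: "nonzero u" and p: "p \<in> OP"
    and w': "w' permutes I" and u': "nonzero u'" and q: "q \<in> OP"
  shows "M_mult b (mseq w u p) (mseq w' u' q) =
    mseq (w \<circ> w') (\<lambda>k. u (w' k) * u' k) (map ((`) (inv' w')) p \<otimes>\<^bsub>P_monoid n\<^esub> q)"
proof -
  define t where "t = (\<lambda>k. u (w' k) * u' k)"
  define r where "r = refine (map ((`) (inv' w')) p) q"
  have p': "map ((`) (inv' w')) p \<in> OP" by (rule P_image_closed[OF permutes_inv[OF w'] p])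
  have t: "nonzero t" using u u' permutes_in_image[OF w'] by (auto simp: t_def)
  have r: "\<Union>(set r) \<subseteq> I" "disjoint_list r"
    using OP_D(2,4)[OF p'] OP_D(2,4)[OF q]
    by (auto simp: r_def Union_refine intro: disjoint_list_refine)
  have "[A \<circ> B. B \<leftarrow> map (mon w' u') q, A \<leftarrow> map (mon w u) p] = map (mon (w \<circ> w') t) r"
  proof -
    have "\<forall>Y\<in>set q. Y \<subseteq> I" "\<forall>X\<in>set p. X \<subseteq> I" using OP_D(2)[OF p] OP_D(2)[OF q] by blast+
    then have "\<forall>X\<in>set p. \<forall>Y\<in>set q. mon w u X \<circ> mon w' u' Y = mon (w \<circ> w') t (inv' w' ` X \<inter> Y)"
      using mon_comp[OF w w'] by (simp add: t_def)
    then show ?thesis unfolding r_def refine_def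
      by (induction q) (auto simp: o_def)
  qed
  then have "M_mult b (mseq w u p) (mseq w' u' q) = restrict_seq (map (mon (w \<circ> w') t) (nonempties r))"
    unfolding M_mult_eq extend_all_mseq[OF w u p] extend_all_mseq[OF w' u' q]
    by (simp only: remove_redundant_mon[OF permutes_compose[OF w' w] t r])
  then show ?thesis by (simp only: mseq_def t_def r_def P_mult)
qed

section \<open>Classes of monomial sequences\<close>

definition cls :: "(nat \<Rightarrow> nat) \<Rightarrow> (nat \<Rightarrow> complex) \<Rightarrow> nat set list \<Rightarrow> 'n pm" where
  "cls w u p = map pclass (mseq w u p)"

text \<open>The scalars may differ from block to block, as each map of a sequence has its own class.\<close>
definition proportional :: "nat set list \<Rightarrow> (nat \<Rightarrow> complex) \<Rightarrow> (nat \<Rightarrow> complex) \<Rightarrow> bool" where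
  "proportional p u u' \<longleftrightarrow> (\<forall>X\<in>set p. \<exists>c. c \<noteq> 0 \<and> (\<forall>k\<in>X. u' k = c * u k))"

lemma cls_eqI:
  assumes w: "w permutes I" and u: "nonzero u" "nonzero u'" and p: "p \<in> OP"
    and uu': "proportional p u u'"
  shows "cls w u p = cls w u' p"
  unfolding cls_def
proof (rule nth_equalityI)
  fix i assume "i < length (map pclass (mseq w u p))"
  then have i: "i < length p" by simp
  then obtain c where c: "c \<noteq> 0" "\<forall>k\<in>p ! i. u' k = c * u k"
    using uu' nth_mem[OF i] unfolding proportional_def by blast
  have "mon w u' (p ! i) v = c *s mon w u (p ! i) v" for v
    unfolding mon_def vec.scale_sum_right using c(2) by (intro sum.cong refl) (simp add: mult_ac)
  then have "mseq w u' p ! i = (\<lambda>v. c *s (mseq w u p ! i) v)"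
    using mseq_nth[OF w u(1) p i] mseq_nth[OF w u(2) p i] by (auto simp: restr_def)
  then show "map pclass (mseq w u p) ! i = map pclass (mseq w u' p) ! i"
    using i c(1) by (simp add: pclass_scale)
qed simp

text \<open>A representative differs from \<open>mseq w u p\<close> by one scalar for each map, and these scalars can be
  absorbed into the coefficients because each index belongs to exactly one block.\<close>
lemma representatives_of_cls:
  assumes w: "w permutes I" and u: "nonzero u" and p: "p \<in> OP" and As: "map pclass As = cls w u p"
  obtains u' where "nonzero u'" "proportional p u u'" "As = mseq w u' p"
proof -
  have len: "length As = length p" using arg_cong[OF As, of length] by (simp add: cls_def)
  have "\<exists>c. c \<noteq> 0 \<and> As ! i = (\<lambda>v. c *s (mseq w u p ! i) v)" if "i < length p" for i
  proof -
    have "pclass (mseq w u p ! i) = pclass (As ! i)"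
      using arg_cong[OF As, of "\<lambda>L. L ! i"] that len by (simp add: cls_def)
    then show ?thesis by (simp add: pclass_eq_iff)
  qed
  then obtain c where c: "\<And>i. i < length p \<Longrightarrow> c i \<noteq> 0"
    "\<And>i. i < length p \<Longrightarrow> As ! i = (\<lambda>v. c i *s (mseq w u p ! i) v)" by metis
  have "\<exists>i<length p. k \<in> p ! i" if "k \<in> I" for k
    using that OP_D(2)[OF p] by (metis UnionE in_set_conv_nth)
  then obtain ix where ix: "\<And>k. k \<in> I \<Longrightarrow> ix k < length p \<and> k \<in> p ! (ix k)" by metis
  have ix_eq: "ix k = i" if "i < length p" "k \<in> p ! i" for i k
    using that ix[of k] OP_D(5)[OF p that(1)] disjoint_list_nth[OF OP_D(4)[OF p], of i "ix k"] by blast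
  define u' where "u' = (\<lambda>k. c (ix k) * u k)"
  have u': "nonzero u'" using u ix c(1) by (auto simp: u'_def)
  have "proportional p u u'"
    unfolding proportional_def
  proof
    fix X assume "X \<in> set p"
    then obtain i where i: "i < length p" "X = p ! i" by (auto simp: in_set_conv_nth)
    show "\<exists>c. c \<noteq> 0 \<and> (\<forall>k\<in>X. u' k = c * u k)"
      using i c(1) ix_eq by (intro exI[of _ "c i"]) (auto simp: u'_def)
  qed
  moreover have "As = mseq w u' p"
  proof (rule nth_equalityI)
    fix i assume "i < length As"
    then have i: "i < length p" using len by simp
    have "mon w u' (p ! i) v = c i *s mon w u (p ! i) v" for v
      unfolding mon_def vec.scale_sum_right u'_def using ix_eq[OF i] by (intro sum.cong refl) (simp add: mult_ac)
    then show "As ! i = mseq w u' p ! i"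
      using c(2)[OF i] mseq_nth[OF w u p i] mseq_nth[OF w u' p i] by (auto simp: restr_def)
  qed (simp add: len)
  ultimately show thesis using that u' by blast
qed

text \<open>Both parameters can be read off from the images of the basis vectors: the index of the map that does
  not kill \<open>b k\<close> gives the block of \<open>k\<close>, and the line of its image gives \<open>w k\<close>.\<close>
lemma mseq_inj:
  assumes w: "w permutes I" "w' permutes I" and u: "nonzero u" "nonzero u'"
    and p: "p \<in> OP" "p' \<in> OP" and eq: "mseq w u p = mseq w' u' p'"
  shows "w = w' \<and> p = p'"
proof -
  have len: "length p = length p'" using arg_cong[OF eq, of length] by simp
  have nz: "u k *s b (w k) \<noteq> 0" "u' k *s b (w' k) \<noteq> 0" if "k \<in> I" for k
    using that u b_nonzero permutes_in_image[OF w(1)] permutes_in_image[OF w(2)]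
    by (metis vec.scale_eq_0_iff)+
  have bl: "k \<in> p ! i \<longleftrightarrow> k \<in> p' ! i" if "i < length p" "k \<in> I" for i k
    using that len mseq_basis[OF w(1) u(1) p(1), of i k] mseq_basis[OF w(2) u(2) p(2), of i k] nz[of k] eq
    by (metis (full_types))
  have pp: "p = p'"
  proof (rule nth_equalityI)
    fix i assume i: "i < length p"
    have "p ! i \<subseteq> I" "p' ! i \<subseteq> I" using OP_D(5)[OF p(1) i] OP_D(5)[OF p(2), of i] i len by auto
    then show "p ! i = p' ! i" using bl[OF i] by blast
  qed (rule len)
  have "w k = w' k" for k
  proof (cases "k \<in> I")
    case True
    then obtain i where i: "i < length p" "k \<in> p ! i"
      using OP_D(2)[OF p(1)] by (metis UnionE in_set_conv_nth)
    have "u k *s b (w k) = u' k *s b (w' k)"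
      using mseq_basis[OF w(1) u(1) p(1) i(1) True] mseq_basis[OF w(2) u(2) p(2) _ True, of i] eq i pp by simp
    then have "crd (w k) (u k *s b (w k)) = crd (w k) (u' k *s b (w' k))" by simp
    then show ?thesis
      using True u permutes_in_image[OF w(1), of k] permutes_in_image[OF w(2), of k]
      by (auto simp: crd_scale crd_basis split: if_splits)
  next
    case False
    then show ?thesis using w by (simp add: permutes_not_in)
  qed
  then show ?thesis using pp by auto
qed

lemma cls_inj:
  assumes "w permutes I" "w' permutes I" "nonzero u" "nonzero u'" "p \<in> OP" "p' \<in> OP"
    and "cls w u p = cls w' u' p'"
  shows "w = w' \<and> p = p'"
proof -
  have "map pclass (mseq w' u' p') = cls w u p" using assms by (simp add: cls_def)
  then obtain u'' where "nonzero u''" "mseq w' u' p' = mseq w u'' p"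
    using representatives_of_cls[OF assms(1,3,5)] by metis
  then show ?thesis using mseq_inj[of w w' u'' u' p p'] assms by simp
qed

subsection \<open>The closure of the monomial group\<close>

definition monomial_pts :: "'n pm set" where
  "monomial_pts = {cls w u p | w u p. w permutes I \<and> nonzero u \<and> p \<in> OP}"

text \<open>Composing with the projection onto the coordinate subspace makes \<open>f\<close> a linear map on the
  whole space, where it is determined by its values on the basis.\<close>
lemma Hom_vanish_mon:
  assumes f: "f \<in> Hom (vanish S)" and S: "S \<subseteq> I"
    and a: "\<And>k. k \<in> I - S \<Longrightarrow> f (b k) = a k *s b (w k)" and v: "v \<in> vanish S"
  shows "f v = mon w a (I - S) v"
proof -
  define P where "P = mon id (\<lambda>_. 1) (I - S)"
  have P: "P x \<in> vanish S" for x
    using crd_mon[OF permutes_id, of "I - S" _ "\<lambda>_. 1" x] S by (auto simp: P_def vanish_def subset_iff)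
  have "P v = v"
    using crd_mon[OF permutes_id, of "I - S" _ "\<lambda>_. 1" v] v by (intro crd_eqI) (auto simp: P_def vanish_def)
  moreover have "(\<lambda>x. f (P x)) = mon w a (I - S)"
  proof (rule Hom_eqI)
    show "(\<lambda>x. f (P x)) \<in> Hom UNIV"
      using f P by (auto simp: Hom_def P_def Hom_add[OF mon_Hom] Hom_scale[OF mon_Hom])
    fix k assume k: "k \<in> I"
    have "0 \<in> vanish S" by (simp add: vanish_def)
    then have "f (0 *s 0) = 0 *s f 0" using f unfolding Hom_def by blast
    then have "f 0 = 0" by simp
    then show "f (P (b k)) = mon w a (I - S) (b k)"
      using k a by (auto simp: P_def mon_basis)
  qed (rule mon_Hom)
  ultimately show ?thesis by metis
qed

text \<open>The hypothesis only speaks of those basis vectors that lie in the domain of the \<open>i\<close>-th map. This is enough: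
  by induction on \<open>i\<close> the domain is a coordinate subspace, because the kernel of a monomial map on a
  coordinate subspace is one again. The blocks are the sets of indices that disappear from one domain
  to the next.\<close>
lemma monomial_imp_mseq:
  assumes As: "As \<in> M_set" and w: "w permutes I"
    and mono: "\<And>i k l. i < length As \<Longrightarrow> k \<in> I \<Longrightarrow> b k \<in> common_ker As i \<Longrightarrow> l \<in> I \<Longrightarrow> l \<noteq> w k \<Longrightarrow>
      crd l ((As ! i) (b k)) = 0"
  shows "\<exists>u p. nonzero u \<and> p \<in> OP \<and> As = mseq w u p"
proof -
  define m where "m = length As"
  define a where "a = (\<lambda>i k. crd (w k) ((As ! i) (b k)))"
  define S where "S = (\<lambda>i. {k \<in> I. b k \<notin> common_ker As i})"
  have SI: "S i \<subseteq> I" for i by (auto simp: S_def)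
  have mono_S: "S i \<subseteq> S j" if "i \<le> j" for i j
    using that less_le_trans unfolding S_def common_ker_eq by blast
  have ab: "(As ! i) (b k) = a i k *s b (w k)" if "i < m" "k \<in> I - S i" for i k
  proof (rule crd_eqI)
    fix l assume "l \<in> I"
    moreover have "w k \<in> I" using that permutes_in_image[OF w] by blast
    ultimately show "crd l ((As ! i) (b k)) = crd l (a i k *s b (w k))"
      using mono[of i k l] that by (auto simp: a_def S_def m_def crd_scale crd_basis)
  qed
  have HomA: "As ! i \<in> Hom (common_ker As i)" "As ! i \<noteq> (\<lambda>v. 0)" if "i < m" for i
    using As that by (auto simp: M_set_def Hom_nonzero_def m_def)
  have Av: "(As ! i) v = mon w (a i) (I - S i) v"
    if "i < m" "common_ker As i = vanish (S i)" "v \<in> vanish (S i)" for i v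
  proof (rule Hom_vanish_mon)
    show "As ! i \<in> Hom (vanish (S i))" using HomA(1)[OF that(1)] that(2) by simp
  qed (use SI ab that in auto)
  have kerS: "common_ker As i = vanish (S i)" if "i \<le> m" for i
    using that
  proof (induction i)
    case 0 then show ?case by (auto simp: S_def vanish_def)
  next
    case (Suc i)
    define S' where "S' = S i \<union> {k \<in> I - S i. a i k \<noteq> 0}"
    have S': "S' \<subseteq> I" using SI by (auto simp: S'_def)
    have "(As ! i) v = 0 \<longleftrightarrow> (\<forall>k\<in>I - S i. crd k v * a i k = 0)" if v: "v \<in> vanish (S i)" for v
    proof -
      have v': "(As ! i) v = mon w (a i) (I - S i) v"
        using Av v Suc by auto
      show ?thesis
      proof
        assume "(As ! i) v = 0"
        then show "\<forall>k\<in>I - S i. crd k v * a i k = 0"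
          using crd_mon[OF w, of "I - S i" _ "a i" v] v' by fastforce
      qed (simp add: v' mon_def sum.neutral del: mult_eq_0_iff)
    qed
    then have ker: "common_ker As (Suc i) = vanish S'" using Suc by (auto simp: vanish_def S'_def)
    then have "S (Suc i) = S'" using basis_in_vanish[OF S'] S' by (auto simp: S_def)
    then show ?case using ker by simp
  qed
  have S0: "S 0 = {}" by (auto simp: S_def)
  have "common_ker As m = {0}" using As by (simp add: M_set_def m_def)
  then have Sm: "S m = I" using b_nonzero by (auto simp: S_def)
  define p where "p = map (\<lambda>i. S (Suc i) - S i) [0..<m]"
  have len: "length p = m" by (simp add: p_def)
  have pi: "p ! i = {k \<in> I - S i. a i k \<noteq> 0}" if i: "i < m" for i
  proof -
    have "k \<in> S (Suc i) \<longleftrightarrow> a i k \<noteq> 0" if "k \<in> I - S i" for k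
    proof -
      have "w k \<in> I" using that permutes_in_image[OF w] by blast
      then show ?thesis using that ab[OF i that] b_nonzero by (auto simp: S_def)
    qed
    then show ?thesis using i SI by (auto simp: p_def)
  qed
  have take: "\<Union>(set (take i p)) = S i" if "i \<le> m" for i
    using that
  proof (induction i)
    case (Suc i)
    then show ?case using mono_S[of i "Suc i"] by (auto simp: take_Suc_conv_app_nth len p_def)
  qed (simp add: S0)
  have Ap: "As ! i = restr (vanish (S i)) (mon w (a i) (p ! i))" if i: "i < m" for i
  proof
    fix v
    show "(As ! i) v = restr (vanish (S i)) (mon w (a i) (p ! i)) v"
    proof (cases "v \<in> vanish (S i)")
      case True
      have "(As ! i) v = mon w (a i) (I - S i) v"
        using Av True kerS i by auto
      also have "\<dots> = mon w (a i) (p ! i) v"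
        unfolding mon_def pi[OF i] by (rule sum.mono_neutral_right) auto
      finally show ?thesis using True by (simp add: restr_def)
    qed (use HomA(1)[OF i] kerS[of i] i in \<open>auto simp: Hom_def restr_def\<close>)
  qed
  have ne: "p ! i \<noteq> {}" if "i < m" for i
  proof
    assume "p ! i = {}"
    then have "As ! i = (\<lambda>v. 0)" unfolding Ap[OF that] by (simp add: fun_eq_iff mon_def restr_def)
    then show False using HomA(2)[OF that] by simp
  qed
  have "m \<noteq> 0" using As by (auto simp: M_set_def m_def)
  moreover have "\<Union>(set p) = I" using take[of m] Sm by (simp add: len)
  moreover have "disjoint_list p"
    unfolding disjoint_list_def sorted_wrt_iff_nth_less len
  proof (intro allI impI)
    fix i j assume ij: "i < j" "j < m"
    then show "p ! i \<inter> p ! j = {}" using mono_S[of "Suc i" j] by (auto simp: p_def)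
  qed
  moreover have "{} \<notin> set p" using ne by (auto simp: in_set_conv_nth len)
  ultimately have p: "p \<in> OP" using len by (auto simp: P_carrier_iff)
  \<comment> \<open>The least such \<open>i\<close> is the index of the block of \<open>k\<close>.\<close>
  define u where "u = (\<lambda>k. a (LEAST i. k \<in> S (Suc i)) k)"
  have ua: "u k = a i k" if "i < m" "k \<in> p ! i" for i k
  proof -
    have k: "k \<in> S (Suc i)" "k \<notin> S i" using that by (auto simp: p_def)
    have "(LEAST i. k \<in> S (Suc i)) = i"
    proof (rule Least_equality, rule k(1))
      fix j assume "k \<in> S (Suc j)"
      then show "i \<le> j" using k(2) mono_S[of "Suc j" i] by (metis not_less_eq_eq subsetD)
    qed
    then show ?thesis by (simp add: u_def)
  qed
  have u: "nonzero u"
  proof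
    fix k assume "k \<in> I"
    then obtain i where "i < m" "k \<in> p ! i" using OP_D(2)[OF p] len by (metis UnionE in_set_conv_nth)
    then show "u k \<noteq> 0" using ua pi by auto
  qed
  have "As = mseq w u p"
  proof (rule nth_equalityI)
    fix i assume "i < length As"
    then have i: "i < m" by (simp add: m_def)
    have "mon w (a i) (p ! i) = mon w u (p ! i)"
      unfolding mon_def using ua[OF i] by (intro ext sum.cong refl) simp
    then show "As ! i = mseq w u p ! i"
      using Ap[OF i] take[of i] i mseq_nth[OF w u p] by (simp add: len)
  qed (simp add: len m_def)
  then show ?thesis using u p by blast
qed

lemma open_coordinate_nonzero: "open {f :: complex ^ 'n \<Rightarrow> complex ^ 'n. crd l (f v) \<noteq> 0}"
proof -
  have "continuous_on UNIV (\<lambda>f :: complex ^ 'n \<Rightarrow> complex ^ 'n. crd l (f v))"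
    by (rule continuous_on_compose2[OF continuous_crd continuous_on_product_coordinates]) auto
  then show ?thesis by (intro open_Collect_neq continuous_on_const)
qed

lemma phom_openI:
  assumes "open Q" and scale: "\<And>f c. f \<in> Q \<Longrightarrow> c \<noteq> 0 \<Longrightarrow> (\<lambda>v. c *s f v) \<in> Q"
  shows "phom_open W (pclass ` (Hom_nonzero W \<inter> Q))"
proof -
  have "{f \<in> Hom_nonzero W. pclass f \<in> pclass ` (Hom_nonzero W \<inter> Q)} = Hom_nonzero W \<inter> Q"
  proof (intro equalityI subsetI)
    fix f assume "f \<in> {f \<in> Hom_nonzero W. pclass f \<in> pclass ` (Hom_nonzero W \<inter> Q)}"
    then obtain g where f: "f \<in> Hom_nonzero W" and g: "g \<in> Q" "pclass g = pclass f" by auto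
    obtain c where "c \<noteq> 0" "f = (\<lambda>v. c *s g v)" using g(2) unfolding pclass_eq_iff by blast
    then show "f \<in> Hom_nonzero W \<inter> Q" using scale[OF g(1)] f by simp
  qed auto
  then show ?thesis using \<open>open Q\<close> by (auto simp: phom_open_def PHom_def openin_open_Int)
qed

text \<open>For each permutation \<open>w\<close> a sequence that is not monomial has a nonzero coordinate \<open>lw w\<close> of the image of
  \<open>b (kw w)\<close> under the map with index \<open>iw w\<close>, where a monomial sequence with permutation \<open>w\<close> has the coordinate 0. The
  finitely many conditions that these coordinates stay nonzero define the neighbourhood.\<close>
lemma closedin_monomial_pts: "closedin PM_topology monomial_pts"
proof -
  have sub: "monomial_pts \<subseteq> PM" by (auto simp: monomial_pts_def PM_def cls_def mseq_in_M)
  have "pm_open (PM - monomial_pts)"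
    unfolding pm_open_def
  proof (intro conjI ballI impI)
    fix As :: "(complex ^ 'n \<Rightarrow> complex ^ 'n) list"
    assume As: "As \<in> M_set" and non: "map pclass As \<in> PM - monomial_pts"
    let ?K = "common_ker As"
    have "\<exists>i k l. i < length As \<and> k \<in> I \<and> b k \<in> ?K i \<and> l \<in> I \<and> l \<noteq> w k \<and> crd l ((As ! i) (b k)) \<noteq> 0"
      if "w permutes I" for w
      using monomial_imp_mseq[OF As that] non that unfolding monomial_pts_def cls_def by blast
    then obtain iw kw lw where ikl: "\<And>w. w permutes I \<Longrightarrow> iw w < length As \<and> kw w \<in> I \<and>
        b (kw w) \<in> ?K (iw w) \<and> lw w \<in> I \<and> lw w \<noteq> w (kw w) \<and> crd (lw w) ((As ! iw w) (b (kw w))) \<noteq> 0"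
      by metis
    define Q where "Q = (\<lambda>i. \<Inter>w\<in>{w. w permutes I \<and> iw w = i}.
      {f :: complex ^ 'n \<Rightarrow> complex ^ 'n. crd (lw w) (f (b (kw w))) \<noteq> 0})"
    have fin: "finite {w. w permutes I \<and> iw w = i}" for i
      using finite_permutations[of I] by (rule finite_subset[rotated]) auto
    have Qo: "open (Q i)" for i unfolding Q_def by (intro open_INT fin ballI open_coordinate_nonzero)
    define Us where "Us = map (\<lambda>i. pclass ` (Hom_nonzero (?K i) \<inter> Q i)) [0..<length As]"
    have "nbhd_data As Us"
      unfolding nbhd_data_def openin_phom_topology
    proof (intro conjI allI impI)
      fix i assume i: "i < length As"
      have "As ! i \<in> Hom_nonzero (?K i)" using As i by (simp add: M_set_def)
      moreover have "As ! i \<in> Q i" using ikl by (auto simp: Q_def)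
      ultimately show "pclass (As ! i) \<in> Us ! i" using i by (auto simp: Us_def)
      show "phom_open (?K i) (Us ! i)"
        using i phom_openI[OF Qo] by (auto simp: Us_def Q_def crd_scale)
    qed (simp add: Us_def)
    moreover have "basic_nbhd As Us \<subseteq> PM - monomial_pts"
    proof
      fix y assume "y \<in> basic_nbhd As Us"
      then obtain Bs where y: "y = map pclass Bs" and Bs: "Bs \<in> M_set"
        and near: "\<And>i. i < length As \<Longrightarrow> \<exists>j<length Bs. ?K i \<subseteq> common_ker Bs j \<and>
            pclass (restr (?K i) (Bs ! j)) \<in> Us ! i"
        unfolding basic_nbhd_def by blast
      have "y \<notin> monomial_pts"
      proof
        assume "y \<in> monomial_pts"
        then obtain w u p where w: "w permutes I" and u: "nonzero u" and p: "p \<in> OP"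
          and "map pclass Bs = cls w u p" by (auto simp: monomial_pts_def y)
        then obtain u' where u': "nonzero u'" and Bs_eq: "Bs = mseq w u' p"
          using representatives_of_cls by metis
        note ikl = ikl[OF w]
        obtain j where j: "j < length p" and "pclass (restr (?K (iw w)) (Bs ! j)) \<in> Us ! iw w"
          using near[of "iw w"] ikl Bs_eq by auto
        then obtain f where f: "f \<in> Q (iw w)" "pclass (restr (?K (iw w)) (Bs ! j)) = pclass f"
          using ikl by (auto simp: Us_def)
        then obtain c where "f = (\<lambda>v. c *s restr (?K (iw w)) (Bs ! j) v)" by (auto simp: pclass_eq_iff)
        moreover have "crd (lw w) (f (b (kw w))) \<noteq> 0" using f(1) w by (auto simp: Q_def)
        ultimately have "crd (lw w) ((Bs ! j) (b (kw w))) \<noteq> 0" using ikl by (auto simp: restr_def crd_scale)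
        moreover have "w (kw w) \<in> I" using ikl permutes_in_image[OF w] by blast
        ultimately show False
          using mseq_basis[OF w u' p j] ikl by (auto simp: Bs_eq crd_scale crd_basis split: if_splits)
      qed
      then show "y \<in> PM - monomial_pts" using y Bs by (auto simp: PM_def)
    qed
    ultimately show "\<exists>Us. nbhd_data As Us \<and> basic_nbhd As Us \<subseteq> PM - monomial_pts" by blast
  qed simp
  then show ?thesis using sub by (simp add: closedin_def topspace_PM_topology openin_PM_topology)
qed

lemma n_pos: "n \<ge> 1"
proof -
  have "0 < CARD('n)" by (rule zero_less_card_finite)
  then show ?thesis using card by linarith
qed

lemma trivial_OP: "[I] \<in> OP"
  using n_pos by (auto simp: P_carrier_iff disjoint_list_def)

lemma mseq_trivial: "w permutes I \<Longrightarrow> nonzero u \<Longrightarrow> mseq w u [I] = [mon w u I]"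
  by (auto simp: mseq_def restrict_seq_def restr_def)

text \<open>The approximating elements have coefficients \<open>\<epsilon> ^ i * u k\<close> for \<open>k\<close> in the block \<open>p ! i\<close>. On the
  domain of the \<open>i\<close>-th map only blocks from \<open>i\<close> on are seen, so dividing by \<open>\<epsilon> ^ i\<close> leaves
  nonnegative powers of \<open>\<epsilon>\<close>, and at \<open>\<epsilon> = 0\<close> exactly the block \<open>p ! i\<close> remains.\<close>
lemma monomial_pts_in_closure:
  assumes w: "w permutes I" and u: "nonzero u" and p: "p \<in> OP"
    and S: "pm_open S" and S_in: "cls w u p \<in> S"
  shows "\<exists>u'. nonzero u' \<and> cls w u' [I] \<in> S"
proof -
  let ?As = "mseq w u p"
  let ?W = "\<lambda>i. vanish (\<Union>(set (take i p)))"
  have "?As \<in> M_set" using mseq_in_M[OF w u p] .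
  then obtain Us where Us: "nbhd_data ?As Us" "basic_nbhd ?As Us \<subseteq> S"
    using S S_in unfolding pm_open_def cls_def by blast
  have "\<exists>i<length p. k \<in> p ! i" if "k \<in> I" for k
    using that OP_D(2)[OF p] by (metis UnionE in_set_conv_nth)
  then obtain ix where ix: "\<And>k. k \<in> I \<Longrightarrow> ix k < length p \<and> k \<in> p ! (ix k)" by metis
  have ix_eq: "ix k = i \<longleftrightarrow> k \<in> p ! i" if "i < length p" "k \<in> I" for i k
    using that ix[of k] disjoint_list_nth[OF OP_D(4)[OF p], of i "ix k"] by blast
  have ix_ge: "i \<le> ix k" if "i < length p" "k \<in> I" "k \<notin> \<Union>(set (take i p))" for i k
  proof (rule ccontr)
    assume "\<not> i \<le> ix k"
    then have "p ! ix k \<in> set (take i p)"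
      using that by (auto simp: in_set_conv_nth intro!: exI[of _ "ix k"])
    then show False using that ix[of k] by blast
  qed
  \<comment> \<open>Truncated subtraction is harmless here: on the domain \<open>?W i\<close> only indices with \<open>i \<le> ix k\<close> count.\<close>
  define g where "g = (\<lambda>i \<epsilon>. restr (?W i) (mon w (\<lambda>k. \<epsilon> ^ (ix k - i) * u k) I))"
  have g0: "g i 0 = ?As ! i" if i: "i < length p" for i
  proof
    fix v
    show "g i 0 v = (?As ! i) v"
    proof (cases "v \<in> ?W i")
      case True
      have "crd k v * (0 ^ (ix k - i) * u k) = 0" if k: "k \<in> I - p ! i" for k
      proof (cases "k \<in> \<Union>(set (take i p))")
        case False
        then have "i \<le> ix k" "ix k \<noteq> i" using ix_ge[OF i] ix_eq[OF i] k by blast+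
        then have "ix k - i \<noteq> 0" by linarith
        then show ?thesis by (simp add: power_0_left)
      qed (use True in \<open>auto simp: vanish_def\<close>)
      then have "mon w (\<lambda>k. 0 ^ (ix k - i) * u k) I v = mon w (\<lambda>k. 0 ^ (ix k - i) * u k) (p ! i) v"
        unfolding mon_def using OP_D(5)[OF p i] by (intro sum.mono_neutral_right) auto
      also have "\<dots> = mon w u (p ! i) v"
      proof -
        have "ix k - i = 0" if "k \<in> p ! i" for k using that ix_eq[OF i] OP_D(5)[OF p i] by auto
        then show ?thesis unfolding mon_def by (intro sum.cong refl) simp
      qed
      finally show ?thesis using True mseq_nth[OF w u p i] by (simp add: g_def restr_def)
    qed (use mseq_nth[OF w u p i] in \<open>simp add: g_def restr_def\<close>)
  qed
  have cont: "continuous_on UNIV (g i)" for i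
  proof (rule continuous_on_coordinatewise_then_product)
    fix v
    have "continuous_on UNIV (\<lambda>\<epsilon>. (crd k v * (\<epsilon> ^ (ix k - i) * u k)) *s b (w k))" for k
      unfolding vector_scalar_mult_def by (intro continuous_intros)
    then have "continuous_on UNIV (\<lambda>\<epsilon>. mon w (\<lambda>k. \<epsilon> ^ (ix k - i) * u k) I v)"
      unfolding mon_def by (intro continuous_on_sum) auto
    then show "continuous_on UNIV (\<lambda>\<epsilon>. g i \<epsilon> v)"
      by (cases "v \<in> ?W i") (auto simp: g_def restr_def)
  qed
  have ev: "\<forall>\<^sub>F \<epsilon> in at 0. g i \<epsilon> \<in> Hom_nonzero (?W i) \<longrightarrow> pclass (g i \<epsilon>) \<in> Us ! i" if i: "i < length p" for i
  proof -
    have ph: "phom_open (?W i) (Us ! i)" "pclass (?As ! i) \<in> Us ! i"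
      using Us(1) i common_ker_mseq[OF w u p, of i]
      by (auto simp: nbhd_data_def openin_phom_topology)
    then obtain Q where Q: "open Q" "{f \<in> Hom_nonzero (?W i). pclass f \<in> Us ! i} = Hom_nonzero (?W i) \<inter> Q"
      by (auto simp: phom_open_def openin_open)
    have "?As ! i \<in> Hom_nonzero (?W i)"
      using mseq_in_M[OF w u p] i common_ker_mseq[OF w u p, of i] by (auto simp: M_set_def)
    then have "g i 0 \<in> Q" using Q(2) ph(2) g0[OF i] by auto
    moreover have "(g i \<longlongrightarrow> g i 0) (at 0)" using cont[of i] by (simp add: continuous_on_def)
    ultimately have "\<forall>\<^sub>F \<epsilon> in at 0. g i \<epsilon> \<in> Q" using topological_tendstoD Q(1) by blast
    then show ?thesis by (rule eventually_mono) (use Q(2) in auto)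
  qed
  then have "\<forall>\<^sub>F \<epsilon> in at (0::complex). \<forall>i\<in>{..<length p}. g i \<epsilon> \<in> Hom_nonzero (?W i) \<longrightarrow> pclass (g i \<epsilon>) \<in> Us ! i"
    by (intro eventually_ball_finite) auto
  moreover have "\<forall>\<^sub>F \<epsilon> in at (0::complex). \<epsilon> \<noteq> 0" by (simp add: eventually_at_filter)
  ultimately have "\<forall>\<^sub>F \<epsilon> in at (0::complex). \<epsilon> \<noteq> 0 \<and>
      (\<forall>i\<in>{..<length p}. g i \<epsilon> \<in> Hom_nonzero (?W i) \<longrightarrow> pclass (g i \<epsilon>) \<in> Us ! i)"
    by eventually_elim auto
  from eventually_happens'[OF at_neq_bot this] obtain \<epsilon> :: complex where \<epsilon>: "\<epsilon> \<noteq> 0"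
    "\<forall>i\<in>{..<length p}. g i \<epsilon> \<in> Hom_nonzero (?W i) \<longrightarrow> pclass (g i \<epsilon>) \<in> Us ! i" by blast
  define u' where "u' = (\<lambda>k. \<epsilon> ^ ix k * u k)"
  have u': "nonzero u'" using \<epsilon>(1) u by (auto simp: u'_def)
  have "cls w u' [I] \<in> basic_nbhd ?As Us"
    unfolding basic_nbhd_def cls_def
  proof (intro CollectI exI[of _ "mseq w u' [I]"] conjI refl allI impI mseq_in_M[OF w u' trivial_OP] exI[of _ 0])
    fix i assume "i < length ?As"
    then have i: "i < length p" by simp
    show "common_ker ?As i \<subseteq> common_ker (mseq w u' [I]) 0" by simp
    have eq: "restr (?W i) (mon w u' I) = (\<lambda>v. \<epsilon> ^ i *s g i \<epsilon> v)"
    proof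
      fix v
      have "crd k v * u' k = \<epsilon> ^ i * (crd k v * (\<epsilon> ^ (ix k - i) * u k))" if "v \<in> ?W i" "k \<in> I" for k
      proof (cases "k \<in> \<Union>(set (take i p))")
        case False
        then have "\<epsilon> ^ ix k = \<epsilon> ^ i * \<epsilon> ^ (ix k - i)"
          using ix_ge[OF i that(2)] by (simp flip: power_add)
        then show ?thesis by (simp add: u'_def)
      qed (use that in \<open>auto simp: vanish_def\<close>)
      then show "restr (?W i) (mon w u' I) v = \<epsilon> ^ i *s g i \<epsilon> v"
        by (auto simp: restr_def g_def mon_def vec.scale_sum_right intro!: sum.cong simp del: mult_cancel_left)
    qed
    have "p ! i \<noteq> {}" using OP_D(3)[OF p] i by (metis nth_mem)
    then obtain k where k: "k \<in> p ! i" by blast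
    have kI: "k \<in> I" using OP_D(5)[OF p i] k by blast
    have kW: "b k \<in> ?W i" using OP_D(7)[OF p i] k basis_in_vanish[OF OP_D(6)[OF p] kI] by blast
    have "w k \<in> I" using kI permutes_in_image[OF w] by blast
    then have "g i \<epsilon> (b k) \<noteq> 0"
      using kW kI u \<epsilon>(1) b_nonzero by (simp add: g_def restr_def mon_basis)
    moreover have "g i \<epsilon> \<in> Hom (?W i)"
      unfolding g_def Hom_def restr_def
      by (auto simp: Hom_add[OF mon_Hom] Hom_scale[OF mon_Hom] vanish_def crd_add crd_scale)
    ultimately have "g i \<epsilon> \<in> Hom_nonzero (?W i)" by (auto simp: Hom_nonzero_def)
    then have "pclass (g i \<epsilon>) \<in> Us ! i" using \<epsilon>(2) i by blast
    then show "pclass (restr (common_ker ?As i) (mseq w u' [I] ! 0)) \<in> Us ! i"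
      using common_ker_mseq[OF w u p, of i] i \<epsilon>(1) mseq_trivial[OF w u'] by (simp add: eq pclass_scale)
  qed (auto simp: mseq_trivial[OF w u'])
  then show ?thesis using Us(2) u' by blast
qed

theorem closure_of_monomial_group:
  "PM_topology closure_of {cls w u [I] | w u. w permutes I \<and> nonzero u} = monomial_pts"
proof
  show "PM_topology closure_of {cls w u [I] | w u. w permutes I \<and> nonzero u} \<subseteq> monomial_pts"
    using trivial_OP by (intro closure_of_minimal closedin_monomial_pts) (auto simp: monomial_pts_def)
  show "monomial_pts \<subseteq> PM_topology closure_of {cls w u [I] | w u. w permutes I \<and> nonzero u}"
  proof
    fix x assume x: "x \<in> monomial_pts"
    then obtain w u p where wup: "x = cls w u p" "w permutes I" "nonzero u" "p \<in> OP"
      by (auto simp: monomial_pts_def)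
    have "x \<in> topspace PM_topology" using closedin_subset[OF closedin_monomial_pts] x by blast
    then show "x \<in> PM_topology closure_of {cls w u [I] | w u. w permutes I \<and> nonzero u}"
      using monomial_pts_in_closure[OF wup(2-4)] wup(1,2)
      unfolding in_closure_of openin_PM_topology by blast
  qed
qed

section \<open>The diagonal group and its normalizer\<close>

lemma cls_trivial: "w permutes I \<Longrightarrow> nonzero u \<Longrightarrow> cls w u [I] = [pclass (mon w u I)]"
  by (simp add: cls_def mseq_trivial)

lemma mon_cong: "(\<And>k. k \<in> X \<Longrightarrow> w k = w' k \<and> u k = u' k) \<Longrightarrow> mon w u X = mon w' u' X"
  unfolding mon_def by (intro ext sum.cong refl) simp

lemma mon_id: "mon id (\<lambda>_. 1) I = id"
  by (rule Hom_eqI[OF mon_Hom]) (auto simp: mon_basis Hom_def)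

lemma mon_comp_I:
  assumes "w permutes I" "w' permutes I"
  shows "mon w u I \<circ> mon w' u' I = mon (w \<circ> w') (\<lambda>k. u (w' k) * u' k) I"
  using mon_comp[OF assms, of I I u u'] permutes_image[OF permutes_inv[OF assms(2)]] by simp

lemma inj_mon:
  assumes "w permutes I" "nonzero u" shows "inj (mon w u I)"
proof (rule injI)
  fix x y assume "mon w u I x = mon w u I y"
  moreover have "mon w u I (x - y) + mon w u I y = mon w u I x"
    using Hom_add[OF mon_Hom, of w u I "x - y" y] by simp
  ultimately have "mon w u I (x - y) = 0" by simp
  then have "x - y = 0" using mon_eq_0_iff[OF assms subset_refl] by (intro crd_eqI) simp
  then show "x = y" by simp
qed

definition diagonal_torus :: "'n pm set" where
  "diagonal_torus = {cls id u [I] | u. nonzero u}"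

definition monomial_group :: "'n pm set" where
  "monomial_group = {cls w u [I] | w u. w permutes I \<and> nonzero u}"

lemma monomial_group_subset: "monomial_group \<subseteq> carrier PGL"
  using inj_mon mon_Hom unfolding monomial_group_def PGL_carrier by (auto simp: cls_trivial)

lemma diagonal_subset: "diagonal_torus \<subseteq> monomial_group"
  using permutes_id unfolding diagonal_torus_def monomial_group_def by blast

lemma diagonalI: "nonzero u \<Longrightarrow> cls id u [I] \<in> diagonal_torus"
  by (auto simp: diagonal_torus_def)

lemma diagonal_carrier: "diagonal_torus \<subseteq> carrier PGL"
  using diagonal_subset monomial_group_subset by (rule subset_trans)

lemma nonzero_twist: "w permutes I \<Longrightarrow> nonzero u \<Longrightarrow> nonzero u' \<Longrightarrow> nonzero (\<lambda>k. u (w k) * u' k)"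
  using permutes_in_image[of w I] by simp

lemma cls_mult:
  assumes "w permutes I" "w' permutes I" "nonzero u" "nonzero u'"
  shows "cls w u [I] \<otimes>\<^bsub>PGL\<^esub> cls w' u' [I] = cls (w \<circ> w') (\<lambda>k. u (w' k) * u' k) [I]"
  using assms nonzero_twist[OF assms(2-4)] permutes_compose[OF assms(2,1)]
  by (simp add: cls_trivial PGL_mult[OF mon_Hom] mon_comp_I)

lemma cls_one: "cls id (\<lambda>_. 1) [I] = \<one>\<^bsub>PGL\<^esub>"
  by (simp add: cls_trivial permutes_id mon_id PGL_one)

lemma cls_cong: "w permutes I \<Longrightarrow> nonzero u \<Longrightarrow> (\<And>k. k \<in> I \<Longrightarrow> u k = u' k) \<Longrightarrow> cls w u [I] = cls w u' [I]"
  using mon_cong[of I w w u u'] by (simp add: cls_trivial)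

lemma diagonal_inv:
  assumes "nonzero u"
  shows "inv\<^bsub>PGL\<^esub> (cls id u [I]) = cls id (\<lambda>k. inverse (u k)) [I]"
proof -
  interpret group PGL by (rule group_PGL)
  have u': "nonzero (\<lambda>k. inverse (u k))" using assms by simp
  have "cls id (\<lambda>k. inverse (u k)) [I] \<otimes>\<^bsub>PGL\<^esub> cls id u [I] = cls id (\<lambda>k. inverse (u k) * u k) [I]"
    using cls_mult[OF permutes_id permutes_id u' assms] by simp
  also have "\<dots> = cls id (\<lambda>_. 1) [I]" using assms by (intro cls_cong permutes_id) auto
  finally show ?thesis
    using diagonalI[OF assms] diagonalI[OF u'] diagonal_carrier
    by (intro inv_equality) (auto simp: cls_one)
qed

lemma subgroup_diagonal: "subgroup diagonal_torus PGL"
proof -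
  interpret group PGL by (rule group_PGL)
  show ?thesis
  proof (rule subgroupI)
    show "diagonal_torus \<subseteq> carrier PGL" by (rule diagonal_carrier)
    show "diagonal_torus \<noteq> {}" using diagonalI[of "\<lambda>_. 1"] by auto
    fix x assume "x \<in> diagonal_torus"
    then obtain u where u: "x = cls id u [I]" "nonzero u" by (auto simp: diagonal_torus_def)
    have "nonzero (\<lambda>k. inverse (u k))" using u by simp
    then show "inv\<^bsub>PGL\<^esub> x \<in> diagonal_torus"
      unfolding u(1) diagonal_inv[OF u(2)] by (rule diagonalI)
    fix y assume "y \<in> diagonal_torus"
    then obtain u' where u': "y = cls id u' [I]" "nonzero u'" by (auto simp: diagonal_torus_def)
    have "nonzero (\<lambda>k. u k * u' k)" using u u' by simp
    then show "x \<otimes>\<^bsub>PGL\<^esub> y \<in> diagonal_torus"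
      using cls_mult[OF permutes_id permutes_id u(2) u'(2)] diagonalI by (simp add: u(1) u'(1))
  qed
qed

text \<open>Comparing coordinates shows that \<open>d k = s * u l\<close> whenever \<open>A (b k)\<close> has a nonzero \<open>l\<close>-th
  coordinate. As the values of \<open>d\<close> are distinct, each \<open>l\<close> is hit by at most one \<open>k\<close>, and injectivity of \<open>A\<close>
  makes each \<open>k\<close> hit some \<open>l\<close>; by counting, this correspondence is a permutation.\<close>
lemma commuting_eigen_monomial:
  assumes A: "A \<in> Hom UNIV" "inj A" and d: "inj_on d I" and s: "s \<noteq> 0"
    and eq: "A \<circ> mon id d I = (\<lambda>v. s *s mon id u I (A v))"
  shows "\<exists>w t. w permutes I \<and> nonzero t \<and> A = mon w t I"
proof -
  have *: "d k * crd l (A (b k)) = s * u l * crd l (A (b k))" if k: "k \<in> I" and l: "l \<in> I" for k l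
  proof -
    have "d k *s A (b k) = s *s mon id u I (A (b k))"
      using fun_cong[OF eq, of "b k"] k by (simp add: mon_basis Hom_scale[OF A(1)])
    then have "crd l (d k *s A (b k)) = crd l (s *s mon id u I (A (b k)))" by simp
    then show ?thesis
      using crd_mon[OF permutes_id subset_refl l, of u "A (b k)"] l by (simp add: crd_scale mult_ac)
  qed
  have uniq: "k = k'" if "k \<in> I" "k' \<in> I" "l \<in> I" "crd l (A (b k)) \<noteq> 0" "crd l (A (b k')) \<noteq> 0" for k k' l
    using *[of k l] *[of k' l] that d by (auto simp: inj_on_def)
  have "\<exists>l\<in>I. crd l (A (b k)) \<noteq> 0" if k: "k \<in> I" for k
  proof (rule ccontr)
    assume "\<not> (\<exists>l\<in>I. crd l (A (b k)) \<noteq> 0)"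
    then have "A (b k) = A 0" using Hom_zero[OF A(1)] by (intro crd_eqI) auto
    then show False using A(2) b_nonzero[OF k] by (simp add: inj_eq)
  qed
  then obtain w0 where w0: "\<And>k. k \<in> I \<Longrightarrow> w0 k \<in> I \<and> crd (w0 k) (A (b k)) \<noteq> 0" by metis
  define w where "w = (\<lambda>k. if k \<in> I then w0 k else k)"
  have "inj_on w0 I" using w0 uniq by (metis inj_onI)
  then have inj: "inj_on w I" by (simp add: w_def inj_on_def)
  have "w ` I \<subseteq> I" using w0 by (auto simp: w_def)
  then have "bij_betw w I I" using inj by (simp add: bij_betw_def endo_inj_surj)
  then have w: "w permutes I" by (rule bij_imp_permutes) (simp add: w_def)
  define t where "t = (\<lambda>k. crd (w k) (A (b k)))"
  have "A = mon w t I"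
  proof (rule Hom_eqI[OF A(1) mon_Hom])
    fix k assume k: "k \<in> I"
    show "A (b k) = mon w t I (b k)"
    proof (rule crd_eqI)
      fix l assume l: "l \<in> I"
      obtain k' where k': "k' \<in> I" "l = w k'" using \<open>bij_betw w I I\<close> l by (auto simp: bij_betw_def)
      have "crd l (A (b k)) = 0" if "k' \<noteq> k"
        using uniq[of k k' l] w0[OF k'(1)] k k' l that by (auto simp: w_def)
      moreover have "w k \<in> I" using k w0 by (simp add: w_def)
      moreover have "w k' = w k \<longleftrightarrow> k' = k" using inj k k'(1) by (simp add: inj_on_eq_iff)
      ultimately show "crd l (A (b k)) = crd l (mon w t I (b k))"
        using k l k' by (auto simp: mon_basis crd_scale crd_basis t_def)
    qed
  qed
  moreover have "nonzero t" using w0 by (simp add: t_def w_def)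
  ultimately show ?thesis using w by blast
qed

lemma normalizer_diagonal: "normalizer PGL diagonal_torus = monomial_group"
proof -
  interpret group "PGL :: 'n pm monoid" by (rule group_PGL)
  note D = diagonal_carrier
  note mem = mem_normalizer_iff[OF D]
  show ?thesis
  proof (intro equalityI subsetI)
    fix x assume "x \<in> normalizer PGL diagonal_torus"
    then have x: "x \<in> carrier PGL" and conj: "(\<lambda>h. x \<otimes>\<^bsub>PGL\<^esub> h \<otimes>\<^bsub>PGL\<^esub> inv\<^bsub>PGL\<^esub> x) ` diagonal_torus = diagonal_torus"
      using mem by auto
    obtain A where A: "x = [pclass A]" "A \<in> Hom UNIV" "inj A" using x by (auto simp: PGL_carrier)
    have d: "nonzero of_nat" by (auto simp: atLeastAtMost_iff)
    \<comment> \<open>The diagonal map with eigenvalues \<open>1, \<dots>, n\<close> is invertible with distinct eigenvalues.\<close>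
    define h where "h = cls id of_nat [I]"
    have h: "h \<in> diagonal_torus" using diagonalI[OF d] by (simp add: h_def)
    then obtain u where u: "nonzero u" "x \<otimes>\<^bsub>PGL\<^esub> h \<otimes>\<^bsub>PGL\<^esub> inv\<^bsub>PGL\<^esub> x = cls id u [I]"
      using conj unfolding diagonal_torus_def by blast
    have "x \<otimes>\<^bsub>PGL\<^esub> h = cls id u [I] \<otimes>\<^bsub>PGL\<^esub> x"
    proof -
      have "h \<in> carrier PGL" using h D by blast
      then have "x \<otimes>\<^bsub>PGL\<^esub> h = x \<otimes>\<^bsub>PGL\<^esub> h \<otimes>\<^bsub>PGL\<^esub> inv\<^bsub>PGL\<^esub> x \<otimes>\<^bsub>PGL\<^esub> x"
        using x by (simp add: m_assoc)
      then show ?thesis by (simp only: u(2))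
    qed
    then have "pclass (mon id u I \<circ> A) = pclass (A \<circ> mon id of_nat I)"
      using u(1) d by (simp add: A(1) h_def cls_trivial permutes_id PGL_mult[OF mon_Hom] PGL_mult[OF A(2)])
    then obtain s where "s \<noteq> 0" "A \<circ> mon id of_nat I = (\<lambda>v. s *s mon id u I (A v))"
      by (auto simp: pclass_eq_iff)
    then obtain w t where wt: "w permutes I" "nonzero t" "A = mon w t I"
      using commuting_eigen_monomial[OF A(2,3), of of_nat s u] by (auto simp: inj_on_def)
    then have "x = cls w t [I]" using A(1) by (simp add: cls_trivial)
    then show "x \<in> monomial_group" using wt(1,2) unfolding monomial_group_def by blast
  next
    fix x assume x: "x \<in> monomial_group"
    then obtain w u where w: "w permutes I" and u: "nonzero u" and x_eq: "x = cls w u [I]"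
      by (auto simp: monomial_group_def)
    have xc: "x \<in> carrier PGL" using x monomial_group_subset by blast
    have tw: "x \<otimes>\<^bsub>PGL\<^esub> cls id (\<lambda>k. t (w k)) [I] \<otimes>\<^bsub>PGL\<^esub> inv\<^bsub>PGL\<^esub> x = cls id t [I]" if t: "nonzero t" for t
    proof -
      have t': "nonzero (\<lambda>k. t (w k))" using t permutes_in_image[OF w] by simp
      have c: "cls id t [I] \<in> carrier PGL" using diagonalI[OF t] D by blast
      have "x \<otimes>\<^bsub>PGL\<^esub> cls id (\<lambda>k. t (w k)) [I] = cls id t [I] \<otimes>\<^bsub>PGL\<^esub> x"
        unfolding x_eq using cls_mult[OF w permutes_id u t'] cls_mult[OF permutes_id w t u]
        by (simp add: mult.commute)
      then show ?thesis using xc c by (simp add: m_assoc)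
    qed
    have "(\<lambda>h. x \<otimes>\<^bsub>PGL\<^esub> h \<otimes>\<^bsub>PGL\<^esub> inv\<^bsub>PGL\<^esub> x) ` diagonal_torus = diagonal_torus"
    proof (intro equalityI subsetI)
      fix y assume "y \<in> (\<lambda>h. x \<otimes>\<^bsub>PGL\<^esub> h \<otimes>\<^bsub>PGL\<^esub> inv\<^bsub>PGL\<^esub> x) ` diagonal_torus"
      then obtain t where t: "nonzero t" "y = x \<otimes>\<^bsub>PGL\<^esub> cls id t [I] \<otimes>\<^bsub>PGL\<^esub> inv\<^bsub>PGL\<^esub> x"
        by (auto simp: diagonal_torus_def)
      define t' where "t' = (\<lambda>k. t (inv' w k))"
      have "nonzero t'" using t(1) permutes_in_image[OF permutes_inv[OF w]] by (simp add: t'_def)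
      moreover have "(\<lambda>k. t' (w k)) = t" using permutes_inverses[OF w] by (simp add: t'_def)
      ultimately have "y = cls id t' [I]" using tw[of t'] t(2) by simp
      then show "y \<in> diagonal_torus" using diagonalI[OF \<open>nonzero t'\<close>] by simp
    next
      fix y assume "y \<in> diagonal_torus"
      then obtain t where t: "nonzero t" "y = cls id t [I]" by (auto simp: diagonal_torus_def)
      have "nonzero (\<lambda>k. t (w k))" using t(1) permutes_in_image[OF w] by simp
      then have "cls id (\<lambda>k. t (w k)) [I] \<in> diagonal_torus" by (rule diagonalI)
      then show "y \<in> (\<lambda>h. x \<otimes>\<^bsub>PGL\<^esub> h \<otimes>\<^bsub>PGL\<^esub> inv\<^bsub>PGL\<^esub> x) ` diagonal_torus"
        by (intro image_eqI[where x = "cls id (\<lambda>k. t (w k)) [I]"]) (simp_all add: tw[OF t(1)] t(2))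
    qed
    then show "x \<in> normalizer PGL diagonal_torus" using mem xc by blast
  qed
qed

section \<open>The diagonal group is the maximal torus\<close>

text \<open>Each diagonal class has exactly one representative with last coefficient 1; the other
  coefficients, with their indices shifted to start at 0, are the coordinates of the torus.\<close>
abbreviation torus_coords :: "(nat \<Rightarrow> complex) \<Rightarrow> nat \<Rightarrow> complex" where
  "torus_coords z k \<equiv> (if k < n then z (k - 1) else 1)"

lemma carrier_Gm_power: "carrier (Gm_power m) = (\<Pi>\<^sub>E i\<in>{..<m}. UNIV - {0})"
  by (simp add: Gm_power_def Gm_def)

lemma torus_coords_nonzero: "z \<in> carrier (Gm_power (n - 1)) \<Longrightarrow> nonzero (torus_coords z)"
  by (auto simp: carrier_Gm_power atLeastAtMost_iff PiE_iff)

lemma torus_coords_regular: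
  assumes "k \<in> I"
  shows "(\<lambda>z. torus_coords z k) \<in> Gm_regular (n - 1)"
    and "(\<lambda>z. inverse (torus_coords z k)) \<in> Gm_regular (n - 1)"
proof -
  have "k < n \<Longrightarrow> k - 1 < n - 1" using assms by (auto simp: atLeastAtMost_iff)
  then show "(\<lambda>z. torus_coords z k) \<in> Gm_regular (n - 1)"
    "(\<lambda>z. inverse (torus_coords z k)) \<in> Gm_regular (n - 1)"
    by (cases "k < n"; auto intro: Gm_regular.intros)+
qed

lemma PGL_entry_diagonal:
  assumes u: "nonzero u"
  shows "PGL_entry i j k l (cls id u [I]) =
    mon id u I (axis j 1) $ i * mon id (\<lambda>a. inverse (u a)) I (axis l 1) $ k"
proof -
  have c: "mon id u I \<circ> mon id (\<lambda>a. inverse (u a)) I = id" "mon id (\<lambda>a. inverse (u a)) I \<circ> mon id u I = id"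
    unfolding mon_comp_I[OF permutes_id permutes_id] mon_id[symmetric]
    using u by (auto intro!: mon_cong)
  show ?thesis
    using PGL_entry_eq[OF mon_Hom mon_Hom c] u by (simp add: cls_trivial permutes_id)
qed

lemma coordinate_of_Hom:
  assumes "f \<in> Hom UNIV"
  shows "crd a (f v) = (\<Sum>(s, r)\<in>UNIV. v $ s * crd a (axis r 1) * f (axis s 1) $ r)"
proof -
  have *: "crd a y = (\<Sum>r\<in>UNIV. y $ r * crd a (axis r 1))" for y :: "complex ^ 'n"
    using crd_sum[of a "\<lambda>r. y $ r *s axis r 1" UNIV] by (simp add: basis_expansion crd_scale)
  have "crd a (f v) = (\<Sum>s\<in>UNIV. v $ s * crd a (f (axis s 1)))"
    by (subst Hom_axis_expansion[OF assms]) (simp add: crd_sum crd_scale)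
  also have "\<dots> = (\<Sum>s\<in>UNIV. v $ s * (\<Sum>r\<in>UNIV. f (axis s 1) $ r * crd a (axis r 1)))"
    by (intro sum.cong refl arg_cong2[where f = "(*)"] *)
  also have "\<dots> = (\<Sum>s\<in>UNIV. \<Sum>r\<in>UNIV. v $ s * crd a (axis r 1) * f (axis s 1) $ r)"
    by (simp add: sum_distrib_left mult_ac)
  finally show ?thesis by (simp add: sum.cartesian_product)
qed

text \<open>The coefficients of a diagonal map are linear combinations of its matrix entries in the standard
  basis, and their inverses are linear combinations of those of the inverse matrix. A product of one of each kind is
  a regular function.\<close>
lemma ratio_regular:
  assumes a: "a \<in> I" and c: "c \<in> I"
  shows "\<exists>\<phi>\<in>PGL_regular. \<forall>u. nonzero u \<longrightarrow> \<phi> (cls id u [I]) = u a * inverse (u c)"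
proof -
  define \<phi> where "\<phi> = (\<lambda>x. \<Sum>p\<in>UNIV. \<Sum>q\<in>UNIV.
    (b a $ fst p * crd a (axis (snd p) 1)) * (b c $ fst q * crd c (axis (snd q) 1)) *
      PGL_entry (snd p) (fst p) (snd q) (fst q) x)"
  have "\<phi> \<in> PGL_regular"
    unfolding \<phi>_def by (intro PGL_regular_sum PGL_regular.mult PGL_regular.const PGL_regular.entry)
  moreover have "\<phi> (cls id u [I]) = u a * inverse (u c)" if u: "nonzero u" for u
  proof -
    have *: "t k = (\<Sum>p\<in>UNIV. b k $ fst p * crd k (axis (snd p) 1) * mon id t I (axis (fst p) 1) $ snd p)"
      if "k \<in> I" for t k
      using coordinate_of_Hom[OF mon_Hom, of k id t I "b k"] that
      by (simp add: mon_basis crd_scale crd_basis case_prod_unfold)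
    show ?thesis
      unfolding \<phi>_def PGL_entry_diagonal[OF u]
      by (subst *[OF a, of u], subst *[OF c, of "\<lambda>k. inverse (u k)"]) (simp add: sum_product mult_ac)
  qed
  ultimately show ?thesis by blast
qed

text \<open>Entries of a diagonal map and of its inverse are linear in the coefficients and in their inverses,
  which makes the parametrization regular; its inverse is regular because the coordinates are the
  quotients \<open>u k / u n\<close>, covered by \<open>ratio_regular\<close>.\<close>
lemma torus_diagonal: "torus diagonal_torus"
proof -
  define f where "f = (\<lambda>z. cls id (torus_coords z) [I])"
  let ?G = "Gm_power (n - 1)"
  have nI: "n \<in> I" using n_pos by (simp add: atLeastAtMost_iff)
  have coord: "torus_coords z (Suc i) = z i" "Suc i \<in> I" if "i < n - 1" for z i
    using that by (auto simp: atLeastAtMost_iff)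
  have hom: "f \<in> hom ?G (PGL\<lparr>carrier := diagonal_torus\<rparr>)"
  proof (rule homI)
    fix z assume z: "z \<in> carrier ?G"
    show "f z \<in> carrier (PGL\<lparr>carrier := diagonal_torus\<rparr>)"
      using diagonalI[OF torus_coords_nonzero[OF z]] by (simp add: f_def)
    fix z' assume z': "z' \<in> carrier ?G"
    have nz: "nonzero (\<lambda>k. torus_coords z k * torus_coords z' k)"
      using torus_coords_nonzero[OF z] torus_coords_nonzero[OF z'] by simp
    have "f z \<otimes>\<^bsub>PGL\<^esub> f z' = cls id (\<lambda>k. torus_coords z k * torus_coords z' k) [I]"
      unfolding f_def
      using cls_mult[OF permutes_id permutes_id torus_coords_nonzero[OF z] torus_coords_nonzero[OF z']]
      by (simp only: id_apply comp_id)
    also have "\<dots> = f (z \<otimes>\<^bsub>?G\<^esub> z')"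
      unfolding f_def using nz
      by (intro cls_cong permutes_id) (auto simp: Gm_power_def Gm_def atLeastAtMost_iff)
    finally show "f (z \<otimes>\<^bsub>?G\<^esub> z') = f z \<otimes>\<^bsub>PGL\<lparr>carrier := diagonal_torus\<rparr>\<^esub> f z'" by simp
  qed
  have inj: "inj_on f (carrier ?G)"
  proof (rule inj_onI)
    fix z z' assume z: "z \<in> carrier ?G" "z' \<in> carrier ?G" and eq: "f z = f z'"
    have "pclass (mon id (torus_coords z) I) = pclass (mon id (torus_coords z') I)"
      using eq torus_coords_nonzero z by (simp add: f_def cls_trivial permutes_id)
    then obtain c where c: "mon id (torus_coords z') I = (\<lambda>v. c *s mon id (torus_coords z) I v)"
      by (auto simp: pclass_eq_iff)
    have *: "torus_coords z' k = c * torus_coords z k" if k: "k \<in> I" for k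
    proof -
      have "crd k (mon id (torus_coords z') I (b k)) = crd k (c *s mon id (torus_coords z) I (b k))"
        using c by simp
      then show ?thesis using k by (simp add: mon_basis crd_scale crd_basis)
    qed
    have "c = 1" using *[OF nI] by simp
    have "z i = z' i" if i: "i < n - 1" for i
    proof -
      have "torus_coords z' (Suc i) = c * torus_coords z (Suc i)" by (rule *[OF coord(2)[OF i]])
      then show ?thesis by (simp only: coord(1)[OF i] \<open>c = 1\<close> mult_1_left)
    qed
    then show "z = z'" using z unfolding carrier_Gm_power by (intro PiE_ext) auto
  qed
  have "diagonal_torus \<subseteq> f ` carrier ?G"
  proof
    fix x assume "x \<in> diagonal_torus"
    then obtain u where u: "nonzero u" "x = cls id u [I]" by (auto simp: diagonal_torus_def)
    define z where "z = (\<lambda>i\<in>{..<n - 1}. u (Suc i) * inverse (u n))"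
    have z: "z \<in> carrier ?G" using u(1) nI coord(2) by (auto simp: z_def carrier_Gm_power)
    have "torus_coords z k = inverse (u n) * u k" if k: "k \<in> I" for k
    proof (cases "k < n")
      case True
      then have "k - 1 < n - 1" "Suc (k - 1) = k" using k by (auto simp: atLeastAtMost_iff)
      then show ?thesis using True by (simp add: z_def mult.commute)
    next
      case False
      then have "k = n" using k by (simp add: atLeastAtMost_iff)
      then show ?thesis using u(1) nI by simp
    qed
    then have "proportional [I] u (torus_coords z)"
      using u(1) nI by (auto simp: proportional_def intro!: exI[of _ "inverse (u n)"])
    then have "x = f z"
      unfolding u(2) f_def using cls_eqI[OF permutes_id u(1) torus_coords_nonzero[OF z] trivial_OP] by simp
    then show "x \<in> f ` carrier ?G" using z by blast
  qed
  moreover have "f ` carrier ?G \<subseteq> diagonal_torus" using hom by (auto simp: hom_def)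
  ultimately have "bij_betw f (carrier ?G) diagonal_torus" using inj by (auto simp: bij_betw_def)
  then have iso: "f \<in> iso ?G (PGL\<lparr>carrier := diagonal_torus\<rparr>)" using hom by (simp add: iso_def)
  have fwd: "\<exists>\<psi>\<in>Gm_regular (n - 1). \<forall>z\<in>carrier ?G. \<phi> (f z) = \<psi> z" if "\<phi> \<in> PGL_regular" for \<phi>
    using that
  proof induction
    case (const c) then show ?case by (intro bexI[of _ "\<lambda>_. c"] Gm_regular.const) simp
  next
    case (entry i j k l)
    define \<psi> where "\<psi> = (\<lambda>z. (\<Sum>a\<in>I. crd a (axis j 1) * torus_coords z a * b a $ i) *
        (\<Sum>a\<in>I. crd a (axis l 1) * inverse (torus_coords z a) * b a $ k))"
    have "\<psi> \<in> Gm_regular (n - 1)"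
      unfolding \<psi>_def
      by (intro Gm_regular.mult[OF Gm_regular_sum Gm_regular_sum] Gm_regular.mult[OF Gm_regular.mult]
          Gm_regular.const torus_coords_regular)
    moreover have "PGL_entry i j k l (f z) = \<psi> z" if "z \<in> carrier ?G" for z
      unfolding f_def PGL_entry_diagonal[OF torus_coords_nonzero[OF that]] by (simp add: mon_def \<psi>_def)
    ultimately show ?case by blast
  next
    case (add \<phi> \<phi>')
    then obtain \<psi> \<psi>' where "\<psi> \<in> Gm_regular (n - 1)" "\<psi>' \<in> Gm_regular (n - 1)"
      "\<forall>z\<in>carrier ?G. \<phi> (f z) = \<psi> z" "\<forall>z\<in>carrier ?G. \<phi>' (f z) = \<psi>' z" by blast
    then show ?case by (intro bexI[of _ "\<lambda>z. \<psi> z + \<psi>' z"] Gm_regular.add) auto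
  next
    case (mult \<phi> \<phi>')
    then obtain \<psi> \<psi>' where "\<psi> \<in> Gm_regular (n - 1)" "\<psi>' \<in> Gm_regular (n - 1)"
      "\<forall>z\<in>carrier ?G. \<phi> (f z) = \<psi> z" "\<forall>z\<in>carrier ?G. \<phi>' (f z) = \<psi>' z" by blast
    then show ?case by (intro bexI[of _ "\<lambda>z. \<psi> z * \<psi>' z"] Gm_regular.mult) auto
  qed
  have bwd: "\<exists>\<phi>\<in>PGL_regular. \<forall>z\<in>carrier ?G. \<phi> (f z) = \<psi> z" if "\<psi> \<in> Gm_regular (n - 1)" for \<psi>
    using that
  proof induction
    case (const c) then show ?case by (intro bexI[of _ "\<lambda>_. c"] PGL_regular.const) simp
  next
    case (coord i)
    obtain \<phi> where "\<phi> \<in> PGL_regular" "\<forall>u. nonzero u \<longrightarrow> \<phi> (cls id u [I]) = u (Suc i) * inverse (u n)"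
      using ratio_regular[OF \<open>\<And>z i. i < n - 1 \<Longrightarrow> Suc i \<in> I\<close>[OF coord] nI] by blast
    then show ?case using torus_coords_nonzero coord by (intro bexI[of _ \<phi>]) (auto simp: f_def)
  next
    case (coord_inverse i)
    obtain \<phi> where "\<phi> \<in> PGL_regular" "\<forall>u. nonzero u \<longrightarrow> \<phi> (cls id u [I]) = u n * inverse (u (Suc i))"
      using ratio_regular[OF nI \<open>\<And>z i. i < n - 1 \<Longrightarrow> Suc i \<in> I\<close>[OF coord_inverse]] by blast
    then show ?case using torus_coords_nonzero coord_inverse by (intro bexI[of _ \<phi>]) (auto simp: f_def)
  next
    case (add \<psi> \<psi>')
    then obtain \<phi> \<phi>' where "\<phi> \<in> PGL_regular" "\<phi>' \<in> PGL_regular"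
      "\<forall>z\<in>carrier ?G. \<phi> (f z) = \<psi> z" "\<forall>z\<in>carrier ?G. \<phi>' (f z) = \<psi>' z" by blast
    then show ?case by (intro bexI[of _ "\<lambda>z. \<phi> z + \<phi>' z"] PGL_regular.add) auto
  next
    case (mult \<psi> \<psi>')
    then obtain \<phi> \<phi>' where "\<phi> \<in> PGL_regular" "\<phi>' \<in> PGL_regular"
      "\<forall>z\<in>carrier ?G. \<phi> (f z) = \<psi> z" "\<forall>z\<in>carrier ?G. \<phi>' (f z) = \<psi>' z" by blast
    then show ?case by (intro bexI[of _ "\<lambda>z. \<phi> z * \<phi>' z"] PGL_regular.mult) auto
  qed
  show ?thesis
    unfolding torus_def using subgroup_diagonal iso fwd bwd by blast
qed

lemma maximal_torus_eq_diagonal: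
  assumes T: "maximal_torus T" and diag: "diagonal_in b T"
  shows "T = diagonal_torus"
proof -
  have "T \<subseteq> diagonal_torus"
  proof
    fix x assume x: "x \<in> T"
    then have "x \<in> carrier PGL" using T subgroup.subset by (auto simp: maximal_torus_def torus_def)
    then obtain A where A: "x = [pclass A]" "A \<in> Hom UNIV" "inj A" by (auto simp: PGL_carrier)
    then have "\<forall>i\<in>I. \<exists>c. A (b i) = c *s b i"
      using diag x pclass_self[of A] by (fastforce simp: diagonal_in_def card)
    then obtain c where c: "\<And>i. i \<in> I \<Longrightarrow> A (b i) = c i *s b i" by metis
    have "nonzero c"
    proof
      fix i assume i: "i \<in> I"
      have "A (b i) \<noteq> A 0" using A(3) b_nonzero[OF i] by (simp add: inj_eq)
      then show "c i \<noteq> 0" using c[OF i] Hom_zero[OF A(2)] by auto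
    qed
    moreover have "A = mon id c I" using c by (intro Hom_eqI A(2) mon_Hom) (simp add: mon_basis)
    ultimately show "x \<in> diagonal_torus" using diagonalI[of c] A(1) by (simp add: cls_trivial permutes_id)
  qed
  then show ?thesis using T torus_diagonal by (auto simp: maximal_torus_def)
qed

section \<open>The quotient by the torus\<close>

text \<open>The product does not depend on the representatives: coefficients that are proportional on the blocks
  of the factors have products that are proportional on the intersections of blocks.\<close>
lemma PM_mult_cls:
  assumes w: "w permutes I" "w' permutes I" and u: "nonzero u" "nonzero u'" and p: "p \<in> OP" "q \<in> OP"
  shows "PM_mult b (cls w u p) (cls w' u' q) =
    cls (w \<circ> w') (\<lambda>k. u (w' k) * u' k) (map ((`) (inv' w')) p \<otimes>\<^bsub>P_monoid n\<^esub> q)"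
    (is "_ = cls _ ?t ?r")
proof -
  have im: "map ((`) (inv' w')) p \<in> OP" by (rule P_image_closed[OF permutes_inv[OF w(2)] p(1)])
  have r: "?r \<in> OP" unfolding P_mult by (rule P_mult_closed[OF n_pos im p(2)])
  show ?thesis
    unfolding PM_mult_def
  proof (rule the_equality)
    show "\<exists>As\<in>M_set. \<exists>Bs\<in>M_set. map pclass As = cls w u p \<and> map pclass Bs = cls w' u' q \<and>
        cls (w \<circ> w') ?t ?r = map pclass (M_mult b As Bs)"
      using mseq_in_M[OF w(1) u(1) p(1)] mseq_in_M[OF w(2) u(2) p(2)]
        M_mult_mseq[OF w(1) u(1) p(1) w(2) u(2) p(2)] unfolding cls_def by metis
  next
    fix x assume "\<exists>As\<in>M_set. \<exists>Bs\<in>M_set. map pclass As = cls w u p \<and> map pclass Bs = cls w' u' q \<and>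
        x = map pclass (M_mult b As Bs)"
    then obtain As Bs where AB: "map pclass As = cls w u p" "map pclass Bs = cls w' u' q"
      "x = map pclass (M_mult b As Bs)" by blast
    obtain s where s: "nonzero s" "proportional p u s" "As = mseq w s p"
      using representatives_of_cls[OF w(1) u(1) p(1) AB(1)] by blast
    obtain s' where s': "nonzero s'" "proportional q u' s'" "Bs = mseq w' s' q"
      using representatives_of_cls[OF w(2) u(2) p(2) AB(2)] by blast
    have "x = cls (w \<circ> w') (\<lambda>k. s (w' k) * s' k) ?r"
      unfolding AB(3) s(3) s'(3) M_mult_mseq[OF w(1) s(1) p(1) w(2) s'(1) p(2)] cls_def ..
    also have "\<dots> = cls (w \<circ> w') ?t ?r"
    proof (rule cls_eqI[OF permutes_compose[OF w(2,1)] _ _ r, symmetric])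
      show "nonzero ?t" "nonzero (\<lambda>k. s (w' k) * s' k)"
        using nonzero_twist[OF w(2)] u s(1) s'(1) by blast+
      show "proportional ?r ?t (\<lambda>k. s (w' k) * s' k)"
        unfolding proportional_def
      proof
        fix Z assume "Z \<in> set ?r"
        then obtain X Y where XY: "X \<in> set p" "Y \<in> set q" "Z = inv' w' ` X \<inter> Y"
          by (auto simp: P_mult set_refine)
        obtain c d where cd: "c \<noteq> 0" "\<forall>k\<in>X. s k = c * u k" "d \<noteq> 0" "\<forall>k\<in>Y. s' k = d * u' k"
          using s(2) s'(2) XY unfolding proportional_def by blast
        have "w' k \<in> X" if "k \<in> Z" for k
          using that XY(3) permutes_inverses(1)[OF w(2)] by auto
        then show "\<exists>c. c \<noteq> 0 \<and> (\<forall>k\<in>Z. s (w' k) * s' k = c * (u (w' k) * u' k))"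
          using cd XY(3) by (intro exI[of _ "c * d"]) (auto simp: mult_ac)
      qed
    qed
    finally show "x = cls (w \<circ> w') ?t ?r" .
  qed
qed

definition orbit_of :: "(nat \<Rightarrow> nat) \<Rightarrow> nat set list \<Rightarrow> 'n pm set" where
  "orbit_of w p = {cls w u p | u. nonzero u}"

text \<open>Any coefficients \<open>t\<close> are reached from \<open>u\<close> by the diagonal element whose coefficient at \<open>w k\<close> is
  \<open>t k / u k\<close>.\<close>
lemma diagonal_coset:
  assumes w: "w permutes I" and u: "nonzero u" and p: "p \<in> OP"
  shows "diagonal_torus #>\<^bsub>normalizer_closure b T\<^esub> cls w u p = orbit_of w p"
proof -
  have P: "monoid (P_monoid n)" by (rule monoid_P_monoid[OF n_pos])
  have "map ((`) (inv' w)) [I] \<otimes>\<^bsub>P_monoid n\<^esub> p = p"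
    using monoid.l_one[OF P p] permutes_image[OF permutes_inv[OF w]] by (simp add: P_one)
  then have *: "PM_mult b (cls id s [I]) (cls w u p) = cls w (\<lambda>k. s (w k) * u k) p" if "nonzero s" for s
    using PM_mult_cls[OF permutes_id w that u trivial_OP p] by simp
  have eq: "diagonal_torus #>\<^bsub>normalizer_closure b T\<^esub> cls w u p =
      {PM_mult b (cls id s [I]) (cls w u p) | s. nonzero s}"
    by (auto simp: r_coset_def normalizer_closure_def diagonal_torus_def)
  show ?thesis
    unfolding eq
  proof (intro equalityI subsetI)
    fix x assume "x \<in> {PM_mult b (cls id s [I]) (cls w u p) | s. nonzero s}"
    then obtain s where "nonzero s" "x = cls w (\<lambda>k. s (w k) * u k) p" using * by blast
    then show "x \<in> orbit_of w p" unfolding orbit_of_def using nonzero_twist[OF w _ u] by blast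
  next
    fix x assume "x \<in> orbit_of w p"
    then obtain t where t: "nonzero t" "x = cls w t p" by (auto simp: orbit_of_def)
    define s where "s = (\<lambda>j. if j \<in> I then t (inv' w j) / u (inv' w j) else 1)"
    have s: "nonzero s" using t(1) u permutes_in_image[OF permutes_inv[OF w]] by (simp add: s_def)
    have "s (w k) * u k = t k" if "k \<in> I" for k
      using that u permutes_in_image[OF w, of k] permutes_inverses(2)[OF w] by (simp add: s_def)
    moreover have "k \<in> I" if "X \<in> set p" "k \<in> X" for X k using that OP_D(2)[OF p] by blast
    ultimately have "proportional p t (\<lambda>k. s (w k) * u k)"
      by (auto simp: proportional_def intro!: exI[of _ 1])
    then have "cls w (\<lambda>k. s (w k) * u k) p = x"
      unfolding t(2) using cls_eqI[OF w t(1) nonzero_twist[OF w s u] p] by simp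
    then show "x \<in> {PM_mult b (cls id s [I]) (cls w u p) | s. nonzero s}"
      using *[OF s] s by (intro CollectI exI[of _ s]) simp
  qed
qed

lemma orbit_mult:
  assumes w: "w permutes I" "w' permutes I" and p: "p \<in> OP" "q \<in> OP"
  shows "orbit_of w p <#>\<^bsub>normalizer_closure b T\<^esub> orbit_of w' q =
    orbit_of (w \<circ> w') (map ((`) (inv' w')) p \<otimes>\<^bsub>P_monoid n\<^esub> q)" (is "_ = orbit_of _ ?r")
proof -
  have eq: "orbit_of w p <#>\<^bsub>normalizer_closure b T\<^esub> orbit_of w' q =
      {PM_mult b (cls w u p) (cls w' u' q) | u u'. nonzero u \<and> nonzero u'}"
    unfolding set_mult_def normalizer_closure_def orbit_of_def by auto
  show ?thesis
    unfolding eq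
  proof (intro equalityI subsetI)
    fix x assume "x \<in> {PM_mult b (cls w u p) (cls w' u' q) | u u'. nonzero u \<and> nonzero u'}"
    then obtain u u' where u: "nonzero u" "nonzero u'" "x = cls (w \<circ> w') (\<lambda>k. u (w' k) * u' k) ?r"
      using PM_mult_cls[OF w _ _ p] by blast
    then show "x \<in> orbit_of (w \<circ> w') ?r" unfolding orbit_of_def using nonzero_twist[OF w(2)] by blast
  next
    fix x assume "x \<in> orbit_of (w \<circ> w') ?r"
    then obtain t where t: "nonzero t" "x = cls (w \<circ> w') t ?r" by (auto simp: orbit_of_def)
    then have "x = PM_mult b (cls w (\<lambda>_. 1) p) (cls w' t q)"
      using PM_mult_cls[OF w _ t(1) p, of "\<lambda>_. 1"] by simp
    then show "x \<in> {PM_mult b (cls w u p) (cls w' u' q) | u u'. nonzero u \<and> nonzero u'}"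
      using t(1) by (intro CollectI exI[of _ "\<lambda>_. 1"] exI[of _ t]) simp
  qed
qed

lemma orbit_inj:
  assumes "w permutes I" "w' permutes I" "p \<in> OP" "p' \<in> OP" "orbit_of w p = orbit_of w' p'"
  shows "w = w' \<and> p = p'"
proof -
  have "cls w (\<lambda>_. 1) p \<in> orbit_of w p" by (auto simp: orbit_of_def intro!: exI[of _ "\<lambda>_. 1"])
  then have "cls w (\<lambda>_. 1) p \<in> orbit_of w' p'" using assms(5) by simp
  then obtain u where "nonzero u" "cls w (\<lambda>_. 1) p = cls w' u p'" by (auto simp: orbit_of_def)
  then show ?thesis using cls_inj[OF assms(1,2) _ _ assms(3,4), of "\<lambda>_. 1" u] by simp
qed

lemma carrier_R_monoid: "carrier (R_monoid b diagonal_torus) = {orbit_of w p | w p. w permutes I \<and> p \<in> OP}"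
proof -
  have "carrier (normalizer_closure b diagonal_torus) = monomial_pts"
    using closure_of_monomial_group
    by (simp add: normalizer_closure_def normalizer_diagonal monomial_group_def)
  then have "carrier (R_monoid b diagonal_torus) =
      (\<lambda>x. diagonal_torus #>\<^bsub>normalizer_closure b diagonal_torus\<^esub> x) ` monomial_pts"
    by (simp add: R_monoid_def carrier_FactGroup)
  also have "\<dots> = {orbit_of w p | w p. w permutes I \<and> p \<in> OP}"
  proof (intro equalityI subsetI)
    fix X assume "X \<in> {orbit_of w p | w p. w permutes I \<and> p \<in> OP}"
    then obtain w p where wp: "X = orbit_of w p" "w permutes I" "p \<in> OP" by blast
    then have "X = diagonal_torus #>\<^bsub>normalizer_closure b diagonal_torus\<^esub> cls w (\<lambda>_. 1) p"
      using diagonal_coset[OF wp(2) _ wp(3), of "\<lambda>_. 1"] by simp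
    moreover have "cls w (\<lambda>_. 1) p \<in> monomial_pts"
      unfolding monomial_pts_def using wp by (intro CollectI exI[of _ w] exI[of _ "\<lambda>_. 1"] exI[of _ p]) simp
    ultimately show "X \<in> (\<lambda>x. diagonal_torus #>\<^bsub>normalizer_closure b diagonal_torus\<^esub> x) ` monomial_pts" by blast
  next
    fix X assume "X \<in> (\<lambda>x. diagonal_torus #>\<^bsub>normalizer_closure b diagonal_torus\<^esub> x) ` monomial_pts"
    then obtain w u p where "X = diagonal_torus #>\<^bsub>normalizer_closure b diagonal_torus\<^esub> cls w u p"
      "w permutes I" "nonzero u" "p \<in> OP" by (auto simp: monomial_pts_def)
    then show "X \<in> {orbit_of w p | w p. w permutes I \<and> p \<in> OP}" using diagonal_coset by blast
  qed
  finally show ?thesis .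
qed

end

theorem proposition3p5:
  fixes n :: nat and T :: "('n::finite) pm set" and b :: "nat \<Rightarrow> complex ^ 'n"
  assumes "n \<ge> 1" and "CARD('n) = n"
    and "maximal_torus T"
    and "is_basis b" and "diagonal_in b T"
  shows "matched_pair (P_monoid n) (sym_group n) phi \<and>
    monoid (R_monoid b T) \<and>
    monoid (bicrossed_product (sym_group n) phi (P_monoid n)) \<and>
    (\<exists>h \<in> iso (R_monoid b T) (bicrossed_product (sym_group n) phi (P_monoid n)).
       h \<one>\<^bsub>R_monoid b T\<^esub> = \<one>\<^bsub>bicrossed_product (sym_group n) phi (P_monoid n)\<^esub>)"
proof -
  interpret framed n b using assms(2,4) by unfold_locales
  let ?B = "bicrossed_product (sym_group n) phi (P_monoid n)"
  have T: "T = diagonal_torus" by (rule maximal_torus_eq_diagonal[OF assms(3,5)])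
  have mp: "matched_pair (P_monoid n) (sym_group n) phi" by (rule matched_pair_phi[OF assms(1)])
  have B: "monoid ?B" by (rule monoid_bicrossed_product[OF mp])
  have cB: "carrier ?B = {w. w permutes I} \<times> OP" by (auto simp: bicrossed_product_def sym_group_def)
  define F where "F = (\<lambda>(w, p). orbit_of w p)"
  have "bij_betw F (carrier ?B) (carrier (R_monoid b T))"
    unfolding bij_betw_def
  proof
    show "inj_on F (carrier ?B)"
      unfolding cB F_def by (rule inj_onI) (use orbit_inj in auto)
    show "F ` carrier ?B = carrier (R_monoid b T)"
      unfolding cB F_def T carrier_R_monoid by auto
  qed
  moreover have "F (x \<otimes>\<^bsub>?B\<^esub> y) = F x \<otimes>\<^bsub>R_monoid b T\<^esub> F y" if "x \<in> carrier ?B" "y \<in> carrier ?B" for x y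
    using that unfolding cB
    by (auto simp: F_def R_monoid_def bicrossed_product_def phi_simps sym_group_mult orbit_mult)
  moreover have "F \<one>\<^bsub>?B\<^esub> = \<one>\<^bsub>R_monoid b T\<^esub>"
    by (simp add: F_def R_monoid_def bicrossed_product_def sym_group_one P_one T diagonal_torus_def orbit_of_def)
  ultimately show ?thesis using monoid_iso_transport[OF B] mp B by blast
qed

end
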